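(* Let $P$ be a poset and let $\mathcal{X}(P)$ be the associated $T_0$-Alexandroff space. Then the functor $$[P,\mathbf{Ab}]\to\mathbf{Cosh}(\mathcal{X}(P)),\qquad F\mapsto\widehat{F},$$ where $\widehat{F}(U)=\operatorname{colim}_{x\in U}F(x)$ for each open set $U$ of $\mathcal{X}(P)$, is an equivalence of categories.
   Context: A poset $P$ is viewed as a category with a unique morphism $x\to y$ whenever $x\le y$; $[P,\mathbf{Ab}]$ is the category of functors $P\to\mathbf{Ab}$ (called cellular cosheaves over $P$). $\mathcal{X}(P)$ is the set $P$ with the topology having as basis the sets $U_x=P_{\le x}=\{y\in P\mid y\le x\}$ for $x\in P$. In the definition of $\widehat{F}(U)$, the open set $U\subset P$ is regarded as a subposet of $P$. For a topological space $X$, $\mathrm{Open}(X)$ is the poset of open sets ordered by inclusion, viewed as a category. A precosheaf on $X$ is a functor $F\colon \mathrm{Open}(X)\to\mathbf{Ab}$; homomorphisms are natural transformations. For an open cover $\mathcal{U}$ of an open set $U$, the nerve $\mathtt{N}(\mathcal{U})$ is the poset of nonempty finite subsets $\{U_0,\ldots,U_n\}\subset\mathcal{U}$ with nonempty intersection, ordered by reverse inclusion, and $\operatorname{colim}_{\mathtt{N}(\mathcal{U})}F$ is the colimit of $\{U_0,\ldots,U_n\}\mapsto F(U_0\cap\cdots\cap U_n)$. A precosheaf $F$ is a cosheaf if the natural map $\operatorname{colim}_{\mathtt{N}(\mathcal{U})}F\to F(U)$ is an isomorphism for each open set $U$ and each open cover $\mathcal{U}$ of $U$. $\mathbf{Cosh}(X)$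 is the category of cosheaves on $X$ and natural transformations. *)

theory Defs
  imports "HOL-Algebra.Free_Abelian_Groups" "HOL-Algebra.Weak_Morphisms" "HOL-Analysis.Abstract_Topology"
begin

section \<open>Categories, functors, natural transformations, equivalences\<close>

text \<open>
  Arrows do not carry their source and target, so composition takes the three objects as
  arguments: \<open>Comp C A B D g f\<close> is the composite of \<open>f : A \<rightarrow> B\<close> and \<open>g : B \<rightarrow> D\<close>.
\<close>

record ('o, 'm) category =
  Obj :: "'o set"
  Hom :: "'o \<Rightarrow> 'o \<Rightarrow> 'm set"
  Ident :: "'o \<Rightarrow> 'm"
  Comp :: "'o \<Rightarrow> 'o \<Rightarrow> 'o \<Rightarrow> 'm \<Rightarrow> 'm \<Rightarrow> 'm"

definition is_category :: "('o, 'm) category \<Rightarrow> bool" where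
  "is_category C \<longleftrightarrow>
     (\<forall>A\<in>Obj C. Ident C A \<in> Hom C A A) \<and>
     (\<forall>A\<in>Obj C. \<forall>B\<in>Obj C. \<forall>D\<in>Obj C. \<forall>f\<in>Hom C A B. \<forall>g\<in>Hom C B D.
        Comp C A B D g f \<in> Hom C A D) \<and>
     (\<forall>A\<in>Obj C. \<forall>B\<in>Obj C. \<forall>f\<in>Hom C A B.
        Comp C A A B f (Ident C A) = f \<and> Comp C A B B (Ident C B) f = f) \<and>
     (\<forall>A\<in>Obj C. \<forall>B\<in>Obj C. \<forall>D\<in>Obj C. \<forall>E\<in>Obj C.
        \<forall>f\<in>Hom C A B. \<forall>g\<in>Hom C B D. \<forall>h\<in>Hom C D E.
        Comp C A D E h (Comp C A B D g f) = Comp C A B E (Comp C B D E h g) f)"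

definition is_isomorphism :: "('o, 'm) category \<Rightarrow> 'o \<Rightarrow> 'o \<Rightarrow> 'm \<Rightarrow> bool" where
  "is_isomorphism C A B f \<longleftrightarrow>
     f \<in> Hom C A B \<and>
     (\<exists>g\<in>Hom C B A. Comp C A B A g f = Ident C A \<and> Comp C B A B f g = Ident C B)"

text \<open>
  The values of a functor outside the objects and arrows of its source are left unconstrained.
  Functors differing only there are naturally isomorphic by identities, so this is invisible
  up to equivalence of categories.
\<close>

record ('o1, 'm1, 'o2, 'm2) cfunctor =
  omap :: "'o1 \<Rightarrow> 'o2"
  mmap :: "'o1 \<Rightarrow> 'o1 \<Rightarrow> 'm1 \<Rightarrow> 'm2"

definition is_functor ::
  "('o1, 'm1) category \<Rightarrow> ('o2, 'm2) category \<Rightarrow> ('o1, 'm1, 'o2, 'm2) cfunctor \<Rightarrow> bool" where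
  "is_functor C D F \<longleftrightarrow>
     is_category C \<and> is_category D \<and>
     (\<forall>A\<in>Obj C. omap F A \<in> Obj D) \<and>
     (\<forall>A\<in>Obj C. \<forall>B\<in>Obj C. \<forall>f\<in>Hom C A B. mmap F A B f \<in> Hom D (omap F A) (omap F B)) \<and>
     (\<forall>A\<in>Obj C. mmap F A A (Ident C A) = Ident D (omap F A)) \<and>
     (\<forall>A\<in>Obj C. \<forall>B\<in>Obj C. \<forall>E\<in>Obj C. \<forall>f\<in>Hom C A B. \<forall>g\<in>Hom C B E.
        mmap F A E (Comp C A B E g f) =
        Comp D (omap F A) (omap F B) (omap F E) (mmap F B E g) (mmap F A B f))"

definition id_functor :: "('o, 'm, 'o, 'm) cfunctor" where
  "id_functor = \<lparr>omap = (\<lambda>A. A), mmap = (\<lambda>A B f. f)\<rparr>"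

definition comp_functor ::
  "('o2, 'm2, 'o3, 'm3) cfunctor \<Rightarrow> ('o1, 'm1, 'o2, 'm2) cfunctor \<Rightarrow>
   ('o1, 'm1, 'o3, 'm3) cfunctor" where
  "comp_functor G F =
     \<lparr>omap = (\<lambda>A. omap G (omap F A)),
      mmap = (\<lambda>A B f. mmap G (omap F A) (omap F B) (mmap F A B f))\<rparr>"

definition is_natural ::
  "('o1, 'm1) category \<Rightarrow> ('o2, 'm2) category \<Rightarrow>
   ('o1, 'm1, 'o2, 'm2) cfunctor \<Rightarrow> ('o1, 'm1, 'o2, 'm2) cfunctor \<Rightarrow> ('o1 \<Rightarrow> 'm2) \<Rightarrow> bool" where
  "is_natural C D F G \<eta> \<longleftrightarrow>
     \<eta> \<in> (\<Pi>\<^sub>E A\<in>Obj C. Hom D (omap F A) (omap G A)) \<and>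
     (\<forall>A\<in>Obj C. \<forall>B\<in>Obj C. \<forall>f\<in>Hom C A B.
        Comp D (omap F A) (omap F B) (omap G B) (\<eta> B) (mmap F A B f) =
        Comp D (omap F A) (omap G A) (omap G B) (mmap G A B f) (\<eta> A))"

definition is_natural_iso ::
  "('o1, 'm1) category \<Rightarrow> ('o2, 'm2) category \<Rightarrow>
   ('o1, 'm1, 'o2, 'm2) cfunctor \<Rightarrow> ('o1, 'm1, 'o2, 'm2) cfunctor \<Rightarrow> ('o1 \<Rightarrow> 'm2) \<Rightarrow> bool" where
  "is_natural_iso C D F G \<eta> \<longleftrightarrow>
     is_natural C D F G \<eta> \<and> (\<forall>A\<in>Obj C. is_isomorphism D (omap F A) (omap G A) (\<eta> A))"

definition is_equivalence ::
  "('o1, 'm1) category \<Rightarrow> ('o2, 'm2) category \<Rightarrow> ('o1, 'm1, 'o2, 'm2) cfunctor \<Rightarrow> bool" where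
  "is_equivalence C D F \<longleftrightarrow>
     is_functor C D F \<and>
     (\<exists>G \<eta> \<epsilon>. is_functor D C G \<and>
        is_natural_iso C C id_functor (comp_functor G F) \<eta> \<and>
        is_natural_iso D D (comp_functor F G) id_functor \<epsilon>)"

definition functor_cat ::
  "('o1, 'm1) category \<Rightarrow> ('o2, 'm2) category \<Rightarrow>
   (('o1, 'm1, 'o2, 'm2) cfunctor, 'o1 \<Rightarrow> 'm2) category" where
  "functor_cat C D =
     \<lparr>Obj = {F. is_functor C D F},
      Hom = (\<lambda>F G. {\<eta>. is_natural C D F G \<eta>}),
      Ident = (\<lambda>F. \<lambda>A\<in>Obj C. Ident D (omap F A)),
      Comp = (\<lambda>F G H \<beta> \<alpha>. \<lambda>A\<in>Obj C. Comp D (omap F A) (omap G A) (omap H A) (\<beta> A) (\<alpha> A))\<rparr>"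

definition poset_cat :: "'a set \<Rightarrow> ('a \<Rightarrow> 'a \<Rightarrow> bool) \<Rightarrow> ('a, unit) category" where
  "poset_cat P leq =
     \<lparr>Obj = P, Hom = (\<lambda>x y. {u. leq x y}), Ident = (\<lambda>x. ()), Comp = (\<lambda>x y z g f. ())\<rparr>"


section \<open>Abelian groups and their colimits\<close>

text \<open>
  The category of abelian groups with elements in the type \<open>'u\<close>, which plays the role of the
  universe of small sets.  Homomorphisms are extensional functions, so that arrows are equal
  when they agree on the carrier of their source.
\<close>

definition Ab :: "('u monoid, 'u \<Rightarrow> 'u) category" where
  "Ab =
     \<lparr>Obj = {G. comm_group G},
      Hom = (\<lambda>G H. hom G H \<inter> extensional (carrier G)),
      Ident = (\<lambda>G. \<lambda>x\<in>carrier G. x),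
      Comp = (\<lambda>G H K g f. compose (carrier G) g f)\<rparr>"

definition sum_in :: "('j, 'm) category \<Rightarrow> ('j, 'm, 'u monoid, 'u \<Rightarrow> 'u) cfunctor \<Rightarrow>
    'j \<Rightarrow> 'u \<Rightarrow> 'j \<Rightarrow> 'u" where
  "sum_in J F j a = (\<lambda>i\<in>Obj J. if i = j then a else \<one>\<^bsub>omap F i\<^esub>)"

definition colim_relations :: "('j, 'm) category \<Rightarrow> ('j, 'm, 'u monoid, 'u \<Rightarrow> 'u) cfunctor \<Rightarrow>
    ('j \<Rightarrow> 'u) set" where
  "colim_relations J F =
     {sum_in J F k (mmap F j k m a) \<otimes>\<^bsub>sum_group (Obj J) (omap F)\<^esub>
        inv\<^bsub>sum_group (Obj J) (omap F)\<^esub> (sum_in J F j a) | j k m a.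
      j \<in> Obj J \<and> k \<in> Obj J \<and> m \<in> Hom J j k \<and> a \<in> carrier (omap F j)}"

text \<open>
  The colimit of \<open>F : J \<rightarrow> Ab\<close> is the direct sum of all \<open>F j\<close> modulo the relations identifying
  \<open>a \<in> F j\<close> with its image in \<open>F k\<close> along every arrow \<open>j \<rightarrow> k\<close>.  Its elements are cosets, hence
  live in a larger type; no size restriction on \<open>J\<close> is needed.
\<close>

definition colim_subgroup :: "('j, 'm) category \<Rightarrow> ('j, 'm, 'u monoid, 'u \<Rightarrow> 'u) cfunctor \<Rightarrow>
    ('j \<Rightarrow> 'u) set" where
  "colim_subgroup J F = generate (sum_group (Obj J) (omap F)) (colim_relations J F)"

definition colim_group :: "('j, 'm) category \<Rightarrow> ('j, 'm, 'u monoid, 'u \<Rightarrow> 'u) cfunctor \<Rightarrow>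
    ('j \<Rightarrow> 'u) set monoid" where
  "colim_group J F = sum_group (Obj J) (omap F) Mod colim_subgroup J F"

definition colim_in :: "('j, 'm) category \<Rightarrow> ('j, 'm, 'u monoid, 'u \<Rightarrow> 'u) cfunctor \<Rightarrow>
    'j \<Rightarrow> 'u \<Rightarrow> ('j \<Rightarrow> 'u) set" where
  "colim_in J F j a = colim_subgroup J F #>\<^bsub>sum_group (Obj J) (omap F)\<^esub> sum_in J F j a"

text \<open>
  The homomorphism \<open>L \<rightarrow> A\<close> induced by a cocone \<open>\<phi>\<close> on \<open>F\<close> with vertex \<open>A\<close>, where \<open>L\<close> with the
  coprojections \<open>\<iota>\<close> is a colimit of \<open>F\<close>.
\<close>

definition induced_map :: "('j, 'm) category \<Rightarrow> ('j, 'm, 'u monoid, 'u \<Rightarrow> 'u) cfunctor \<Rightarrow>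
    'l monoid \<Rightarrow> ('j \<Rightarrow> 'u \<Rightarrow> 'l) \<Rightarrow> 'b monoid \<Rightarrow> ('j \<Rightarrow> 'u \<Rightarrow> 'b) \<Rightarrow> 'l \<Rightarrow> 'b" where
  "induced_map J F L \<iota> A \<phi> =
     (THE h. h \<in> hom L A \<inter> extensional (carrier L) \<and>
             (\<forall>j\<in>Obj J. \<forall>a\<in>carrier (omap F j). h (\<iota> j a) = \<phi> j a))"

lemma colim_group_universal:
  fixes A :: "'b monoid"
  assumes F: "is_functor J Ab F" and A: "comm_group A"
    and \<phi>: "\<And>j. j \<in> Obj J \<Longrightarrow> \<phi> j \<in> hom (omap F j) A"
    and cocone: "\<And>j k m a. \<lbrakk>j \<in> Obj J; k \<in> Obj J; m \<in> Hom J j k; a \<in> carrier (omap F j)\<rbrakk>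
                   \<Longrightarrow> \<phi> k (mmap F j k m a) = \<phi> j a"
  shows "\<exists>!h. h \<in> hom (colim_group J F) A \<inter> extensional (carrier (colim_group J F)) \<and>
              (\<forall>j\<in>Obj J. \<forall>a\<in>carrier (omap F j). h (colim_in J F j a) = \<phi> j a)"
proof -
  define I where "I = Obj J"
  define G where "G = omap F"
  define S where "S = sum_group I G"
  define N where "N = colim_subgroup J F"
  define supp where "supp = (\<lambda>x. {i \<in> I. x i \<noteq> \<one>\<^bsub>G i\<^esub>})"
  define \<Phi> where "\<Phi> = (\<lambda>x. finprod A (\<lambda>j. \<phi> j (x j)) (supp x))"
  interpret A: comm_group A by (fact A)
  have cg: "comm_group (G i)" if "i \<in> I" for i
    using F that by (auto simp: is_functor_def Ab_def I_def G_def)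
  have gr: "group (G i)" if "i \<in> I" for i using cg that comm_group.axioms(2) by blast
  have mor: "mmap F j k m a \<in> carrier (G k)"
    if "j \<in> I" "k \<in> I" "m \<in> Hom J j k" "a \<in> carrier (G j)" for j k m a
  proof -
    have "mmap F j k m \<in> hom (G j) (G k)"
      using F that by (auto simp: is_functor_def Ab_def I_def G_def)
    then show ?thesis using that by (auto simp: hom_def)
  qed
  have cS: "carrier S = {x \<in> \<Pi>\<^sub>E i\<in>I. carrier (G i). finite (supp x)}"
    using gr by (simp add: S_def carrier_sum_group supp_def)
  have gS: "group S" using gr by (simp add: S_def)
  have mS: "x \<otimes>\<^bsub>S\<^esub> y = (\<lambda>i\<in>I. x i \<otimes>\<^bsub>G i\<^esub> y i)" for x y by (simp add: S_def)
  interpret S: comm_group S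
  proof (rule group.group_comm_groupI[OF gS])
    fix x y assume "x \<in> carrier S" "y \<in> carrier S"
    then show "x \<otimes>\<^bsub>S\<^esub> y = y \<otimes>\<^bsub>S\<^esub> x"
      unfolding mS cS
      by (intro restrict_ext) (auto intro!: comm_monoid.m_comm comm_group.axioms(1) cg)
  qed
  have \<phi>c: "\<phi> j a \<in> carrier A" if "j \<in> I" "a \<in> carrier (G j)" for j a
    using \<phi>[of j] that by (auto simp: hom_def I_def G_def)
  have \<phi>1: "\<phi> j \<one>\<^bsub>G j\<^esub> = \<one>\<^bsub>A\<^esub>" if "j \<in> I" for j
    using \<phi>[of j] that gr[OF that] by (auto simp: I_def G_def intro: hom_one)
  have \<Phi>eq: "\<Phi> x = finprod A (\<lambda>j. \<phi> j (x j)) K"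
    if "x \<in> carrier S" "finite K" "supp x \<subseteq> K" "K \<subseteq> I" for x K
    unfolding \<Phi>_def
    by (rule A.finprod_mono_neutral_cong_left)
       (use that \<phi>1 \<phi>c in \<open>auto simp: supp_def cS PiE_iff Pi_iff subset_iff\<close>)
  have \<Phi>hom: "\<Phi> \<in> hom S A"
  proof (rule homI)
    fix x assume x: "x \<in> carrier S"
    show "\<Phi> x \<in> carrier A" unfolding \<Phi>_def
      using x by (intro A.finprod_closed) (auto simp: supp_def cS PiE_iff intro!: \<phi>c)
  next
    fix x y assume x: "x \<in> carrier S" and y: "y \<in> carrier S"
    define K where "K = supp x \<union> supp y"
    have K: "finite K" "K \<subseteq> I" using x y by (auto simp: K_def cS supp_def)
    have xy: "x \<otimes>\<^bsub>S\<^esub> y \<in> carrier S" using x y by simp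
    have "supp (x \<otimes>\<^bsub>S\<^esub> y) \<subseteq> K"
      using gr by (auto simp: K_def supp_def mS group.is_monoid)
    then have "\<Phi> (x \<otimes>\<^bsub>S\<^esub> y) = finprod A (\<lambda>j. \<phi> j ((x \<otimes>\<^bsub>S\<^esub> y) j)) K"
      using \<Phi>eq xy K by blast
    also have "\<dots> = finprod A (\<lambda>j. \<phi> j (x j) \<otimes>\<^bsub>A\<^esub> \<phi> j (y j)) K"
    proof (rule A.finprod_cong')
      show "(\<lambda>j. \<phi> j (x j) \<otimes>\<^bsub>A\<^esub> \<phi> j (y j)) \<in> K \<rightarrow> carrier A"
        using K x y by (auto simp: cS PiE_iff intro!: \<phi>c)
      fix j assume "j \<in> K"
      then have "j \<in> I" using K by auto
      then show "\<phi> j ((x \<otimes>\<^bsub>S\<^esub> y) j) = \<phi> j (x j) \<otimes>\<^bsub>A\<^esub> \<phi> j (y j)"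
        using \<phi>[of j] x y by (auto simp: mS hom_def I_def G_def cS PiE_iff)
    qed simp
    also have "\<dots> = finprod A (\<lambda>j. \<phi> j (x j)) K \<otimes>\<^bsub>A\<^esub> finprod A (\<lambda>j. \<phi> j (y j)) K"
      using K x y by (intro A.finprod_multf) (auto simp: cS PiE_iff intro!: \<phi>c)
    also have "\<dots> = \<Phi> x \<otimes>\<^bsub>A\<^esub> \<Phi> y"
      using \<Phi>eq[OF x K(1) _ K(2)] \<Phi>eq[OF y K(1) _ K(2)] by (simp add: K_def)
    finally show "\<Phi> (x \<otimes>\<^bsub>S\<^esub> y) = \<Phi> x \<otimes>\<^bsub>A\<^esub> \<Phi> y" .
  qed
  interpret \<Phi>: group_hom S A \<Phi> using \<Phi>hom by unfold_locales
  have sin: "sum_in J F j a \<in> carrier S" if "j \<in> I" "a \<in> carrier (G j)" for j a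
  proof -
    have "supp (sum_in J F j a) \<subseteq> {j}"
      by (auto simp: supp_def sum_in_def I_def G_def)
    then have "finite (supp (sum_in J F j a))" using finite_subset by blast
    then show ?thesis using that gr
      by (auto simp: cS sum_in_def I_def G_def group.is_monoid)
  qed
  have \<Phi>in: "\<Phi> (sum_in J F j a) = \<phi> j a" if "j \<in> I" "a \<in> carrier (G j)" for j a
  proof -
    have "\<Phi> (sum_in J F j a) = finprod A (\<lambda>i. \<phi> i (sum_in J F j a i)) {j}"
      by (rule \<Phi>eq) (use that sin in \<open>auto simp: supp_def sum_in_def I_def G_def\<close>)
    also have "\<dots> = \<phi> j a" using that \<phi>c[OF that] by (simp add: sum_in_def I_def)
    finally show ?thesis .
  qed
  have rels: "colim_relations J F \<subseteq> kernel S A \<Phi>"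
  proof
    fix r assume "r \<in> colim_relations J F"
    then obtain j k m a where r: "j \<in> I" "k \<in> I" "m \<in> Hom J j k" "a \<in> carrier (G j)"
      "r = sum_in J F k (mmap F j k m a) \<otimes>\<^bsub>S\<^esub> inv\<^bsub>S\<^esub> (sum_in J F j a)"
      by (auto simp: colim_relations_def I_def G_def S_def)
    then have "\<Phi> r = \<phi> k (mmap F j k m a) \<otimes>\<^bsub>A\<^esub> inv\<^bsub>A\<^esub> (\<phi> j a)"
      using sin mor \<Phi>in by simp
    also have "\<dots> = \<one>\<^bsub>A\<^esub>" using cocone[of j k m a] r \<phi>c by (simp add: I_def G_def)
    finally show "r \<in> kernel S A \<Phi>" using r sin mor by (simp add: kernel_def)
  qed
  have relc: "colim_relations J F \<subseteq> carrier S" using rels by (auto simp: kernel_def)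
  have N: "N = generate S (colim_relations J F)"
    by (simp add: N_def colim_subgroup_def S_def I_def G_def)
  have Nsub: "subgroup N S" unfolding N using relc by (rule S.generate_is_subgroup)
  have Nn: "N \<lhd> S" using Nsub by (rule S.subgroup_imp_normal)
  have Nk: "N \<subseteq> kernel S A \<Phi>"
    unfolding N by (rule S.generate_subgroup_incl[OF rels \<Phi>.subgroup_kernel])
  obtain g where g: "g \<in> hom (S Mod N) A" "\<And>x. x \<in> carrier S \<Longrightarrow> g (N #>\<^bsub>S\<^esub> x) = \<Phi> x"
    using \<Phi>.FactGroup_universal_kernel[OF Nn Nk] by blast
  have C: "colim_group J F = S Mod N" "colim_in J F j a = N #>\<^bsub>S\<^esub> sum_in J F j a" for j a
    by (simp_all add: colim_group_def colim_in_def S_def N_def I_def G_def)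
  have cC: "carrier (S Mod N) = (\<lambda>x. N #>\<^bsub>S\<^esub> x) ` carrier S"
    by (auto simp: FactGroup_def RCOSETS_def)
  have uniq: "h (N #>\<^bsub>S\<^esub> x) = \<Phi> x"
    if h: "h \<in> hom (S Mod N) A" and hin: "\<forall>j\<in>I. \<forall>a\<in>carrier (G j). h (N #>\<^bsub>S\<^esub> sum_in J F j a) = \<phi> j a"
      and x: "x \<in> carrier S" for h x
  proof -
    have k: "(\<lambda>x. h (N #>\<^bsub>S\<^esub> x)) \<in> hom S A"
      using hom_compose[OF normal.r_coset_hom_Mod[OF Nn] h] by (simp add: o_def)
    interpret k: group_hom S A "\<lambda>x. h (N #>\<^bsub>S\<^esub> x)" using k by unfold_locales
    have "x \<in> carrier S \<Longrightarrow> supp x = K \<Longrightarrow> h (N #>\<^bsub>S\<^esub> x) = \<Phi> x" if "finite K" for K x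
      using that
    proof (induction K arbitrary: x)
      case empty
      then have "x = \<one>\<^bsub>S\<^esub>"
        unfolding cS supp_def PiE_iff extensional_def by (auto simp: S_def fun_eq_iff)
      then show ?case using k.hom_one \<Phi>.hom_one by simp
    next
      case (insert j K)
      have j: "j \<in> I" using insert by (auto simp: supp_def)
      have xj: "x j \<in> carrier (G j)" using insert j by (auto simp: cS)
      define y where "y = (\<lambda>i\<in>I. if i = j then \<one>\<^bsub>G i\<^esub> else x i)"
      have sy: "supp y = K" using insert by (auto simp: supp_def y_def)
      then have y: "y \<in> carrier S" using insert gr
        by (auto simp: cS y_def PiE_iff group.is_monoid)
      have xy: "x = sum_in J F j (x j) \<otimes>\<^bsub>S\<^esub> y"
        unfolding mS
      proof
        fix i show "x i = (\<lambda>i\<in>I. sum_in J F j (x j) i \<otimes>\<^bsub>G i\<^esub> y i) i"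
          using insert.prems(1) gr[of i] j
          by (cases "i \<in> I") (auto simp: y_def sum_in_def I_def[symmetric] G_def[symmetric] cS PiE_iff extensional_def group.is_monoid)
      qed
      have "h (N #>\<^bsub>S\<^esub> x) = h (N #>\<^bsub>S\<^esub> sum_in J F j (x j)) \<otimes>\<^bsub>A\<^esub> h (N #>\<^bsub>S\<^esub> y)"
        by (subst xy) (use k.hom_mult sin[OF j xj] y in simp)
      also have "\<dots> = \<Phi> (sum_in J F j (x j)) \<otimes>\<^bsub>A\<^esub> \<Phi> y"
        using insert.IH[OF y sy] hin j xj \<Phi>in by simp
      also have "\<dots> = \<Phi> x"
        by (subst (2) xy) (use \<Phi>.hom_mult sin[OF j xj] y in simp)
      finally show ?case .
    qed
    then show ?thesis using x cS by blast
  qed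
  show ?thesis unfolding C I_def[symmetric] G_def[symmetric]
  proof (rule ex1I[of _ "restrict g (carrier (S Mod N))"], goal_cases)
    case 1
    have "restrict g (carrier (S Mod N)) \<in> hom (S Mod N) A"
      using g(1) monoid.m_closed[OF group.is_monoid[OF normal.factorgroup_is_group[OF Nn]]]
      by (auto simp: hom_def Pi_iff simp del: mult_FactGroup)
    then show ?case using g(2) sin \<Phi>in by (auto simp: cC)
  next
    case (2 h)
    show ?case
    proof (rule extensionalityI[of _ "carrier (S Mod N)"])
      fix c assume "c \<in> carrier (S Mod N)"
      then obtain x where "x \<in> carrier S" "c = N #>\<^bsub>S\<^esub> x" unfolding cC by blast
      then show "h c = restrict g (carrier (S Mod N)) c"
        using 2 uniq[of h x] g(2)[of x] by (auto simp: cC)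
    qed (use 2 in auto)
  qed
qed


text \<open>
  Colimits inside \<open>Ab\<close>: when the colimit group is small enough to embed into \<open>'u\<close>, it is
  transported there along a chosen injection.
\<close>

definition colim_embed :: "('j, 'm) category \<Rightarrow> ('j, 'm, 'u monoid, 'u \<Rightarrow> 'u) cfunctor \<Rightarrow>
    ('j \<Rightarrow> 'u) set \<Rightarrow> 'u" where
  "colim_embed J F = (SOME e. inj_on e (carrier (colim_group J F)))"

definition Ab_colim :: "('j, 'm) category \<Rightarrow> ('j, 'm, 'u monoid, 'u \<Rightarrow> 'u) cfunctor \<Rightarrow>
    'u monoid" where
  "Ab_colim J F = image_group (colim_embed J F) (colim_group J F)"

definition Ab_colim_in :: "('j, 'm) category \<Rightarrow> ('j, 'm, 'u monoid, 'u \<Rightarrow> 'u) cfunctor \<Rightarrow>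
    'j \<Rightarrow> 'u \<Rightarrow> 'u" where
  "Ab_colim_in J F j a = colim_embed J F (colim_in J F j a)"


text \<open>
  The size condition under which \<open>Ab\<close> on the universe \<open>'u\<close> has colimits of shape \<open>J\<close>.
\<close>

lemma sum_group_lepoll:
  assumes "infinite (UNIV :: 'u set)" and "I \<lesssim> (UNIV :: 'u set)"
    and "\<And>i. i \<in> I \<Longrightarrow> group (G i :: 'u monoid)"
  shows "carrier (sum_group I G) \<lesssim> (UNIV :: 'u set)"
proof -
  have sq: "(UNIV :: ('u \<times> 'u) set) \<lesssim> (UNIV :: 'u set)"
    using card_of_Times_same_infinite[OF assms(1)] eqpoll_iff_card_of_ordIso eqpoll_imp_lepoll
    by (metis UNIV_Times_UNIV)
  define gr where "gr = (\<lambda>x. {(i, x i) | i. i \<in> I \<and> x i \<noteq> \<one>\<^bsub>G i\<^esub>})"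
  have gr_iff: "(i, a) \<in> gr x \<longleftrightarrow> i \<in> I \<and> a = x i \<and> x i \<noteq> \<one>\<^bsub>G i\<^esub>" for i a x
    by (auto simp: gr_def)
  have inj: "inj_on gr (carrier (sum_group I G))"
  proof (rule inj_onI)
    fix x y assume x: "x \<in> carrier (sum_group I G)" and y: "y \<in> carrier (sum_group I G)"
      and e: "gr x = gr y"
    show "x = y"
    proof (rule extensionalityI[of _ I])
      fix i assume i: "i \<in> I"
      show "x i = y i"
        using gr_iff[of i "x i" x] gr_iff[of i "x i" y] gr_iff[of i "y i" x] gr_iff[of i "y i" y]
        unfolding e using i by metis
    qed (use x y assms(3) in \<open>auto simp: carrier_sum_group PiE_iff\<close>)
  qed
  have sub: "gr ` carrier (sum_group I G) \<subseteq> Fpow (I \<times> UNIV)"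
  proof -
    have "finite (gr x)" if "x \<in> carrier (sum_group I G)" for x
    proof -
      have "gr x = (\<lambda>i. (i, x i)) ` {i \<in> I. x i \<noteq> \<one>\<^bsub>G i\<^esub>}" by (auto simp: gr_def)
      then show ?thesis using that assms(3) by (auto simp: carrier_sum_group)
    qed
    then show ?thesis by (auto simp: Fpow_def gr_def)
  qed
  have "Fpow (I \<times> (UNIV :: 'u set)) \<lesssim> (UNIV :: 'u set)"
  proof -
    have "I \<times> (UNIV :: 'u set) \<lesssim> (UNIV :: ('u \<times> 'u) set)"
      using times_lepoll_mono[OF assms(2) lepoll_refl, of "UNIV :: 'u set"] by simp
    then have "I \<times> (UNIV :: 'u set) \<lesssim> (UNIV :: 'u set)" using sq lepoll_trans by blast
    then obtain r :: "_ \<Rightarrow> 'u" where r: "inj_on r (I \<times> (UNIV :: 'u set))"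
      by (auto simp: lepoll_def)
    have "Fpow (I \<times> (UNIV :: 'u set)) \<lesssim> Fpow (UNIV :: 'u set)"
      unfolding lepoll_def using inj_on_image_Fpow[OF r] image_Fpow_mono[of r "I \<times> UNIV" UNIV] by blast
    also have "Fpow (UNIV :: 'u set) \<lesssim> (UNIV :: 'u set)"
      using eqpoll_Fpow[OF assms(1)] by (rule eqpoll_imp_lepoll)
    finally show ?thesis .
  qed
  moreover have "carrier (sum_group I G) \<lesssim> Fpow (I \<times> (UNIV :: 'u set))"
    unfolding lepoll_def using inj sub by blast
  ultimately show ?thesis using lepoll_trans by blast
qed

lemma inj_on_colim_embed:
  fixes F :: "('j, 'm, 'u monoid, 'u \<Rightarrow> 'u) cfunctor"
  assumes "is_functor J Ab F" and "infinite (UNIV :: 'u set)" and "Obj J \<lesssim> (UNIV :: 'u set)"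
  shows "inj_on (colim_embed J F) (carrier (colim_group J F))"
proof -
  have "group (omap F j)" if "j \<in> Obj J" for j
    using assms(1) that by (auto simp: is_functor_def Ab_def comm_group_def)
  then have *: "carrier (sum_group (Obj J) (omap F)) \<lesssim> (UNIV :: 'u set)"
    using sum_group_lepoll assms(2,3) by blast
  have "carrier (colim_group J F) =
      (\<lambda>x. colim_subgroup J F #>\<^bsub>sum_group (Obj J) (omap F)\<^esub> x) ` carrier (sum_group (Obj J) (omap F))"
    by (auto simp: colim_group_def FactGroup_def RCOSETS_def)
  then have "carrier (colim_group J F) \<lesssim> (UNIV :: 'u set)"
    using image_lepoll lepoll_trans * by metis
  then show ?thesis
    unfolding colim_embed_def lepoll_def by (metis (mono_tags, lifting) someI_ex)
qed


section \<open>Cosheaves\<close>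

definition open_cat :: "'a topology \<Rightarrow> ('a set, unit) category" where
  "open_cat X = poset_cat {U. openin X U} (\<subseteq>)"

definition nerve :: "'a set set \<Rightarrow> ('a set set, unit) category" where
  "nerve \<U> = poset_cat {S. S \<subseteq> \<U> \<and> finite S \<and> S \<noteq> {} \<and> \<Inter>S \<noteq> {}} (\<supseteq>)"

definition nerve_diagram :: "('a set, unit, 'u monoid, 'u \<Rightarrow> 'u) cfunctor \<Rightarrow>
    ('a set set, unit, 'u monoid, 'u \<Rightarrow> 'u) cfunctor" where
  "nerve_diagram F =
     \<lparr>omap = (\<lambda>S. omap F (\<Inter>S)), mmap = (\<lambda>S T m. mmap F (\<Inter>S) (\<Inter>T) m)\<rparr>"

definition nerve_map :: "('a set, unit, 'u monoid, 'u \<Rightarrow> 'u) cfunctor \<Rightarrow>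
    'a set set \<Rightarrow> 'a set \<Rightarrow> ('a set set \<Rightarrow> 'u) set \<Rightarrow> 'u" where
  "nerve_map F \<U> U =
     induced_map (nerve \<U>) (nerve_diagram F)
       (colim_group (nerve \<U>) (nerve_diagram F)) (colim_in (nerve \<U>) (nerve_diagram F))
       (omap F U) (\<lambda>S. mmap F (\<Inter>S) U ())"

definition is_cosheaf :: "'a topology \<Rightarrow> ('a set, unit, 'u monoid, 'u \<Rightarrow> 'u) cfunctor \<Rightarrow> bool" where
  "is_cosheaf X F \<longleftrightarrow>
     is_functor (open_cat X) Ab F \<and>
     (\<forall>U \<U>. openin X U \<and> (\<forall>V\<in>\<U>. openin X V) \<and> \<Union>\<U> = U \<longrightarrow>
        nerve_map F \<U> U \<in> iso (colim_group (nerve \<U>) (nerve_diagram F)) (omap F U))"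

definition Cosh :: "'a topology \<Rightarrow>
    (('a set, unit, 'u monoid, 'u \<Rightarrow> 'u) cfunctor, 'a set \<Rightarrow> 'u \<Rightarrow> 'u) category" where
  "Cosh X = (functor_cat (open_cat X) Ab)\<lparr>Obj := {F. is_cosheaf X F}\<rparr>"


section \<open>The Alexandroff space of a poset and the cosheaf of a cellular cosheaf\<close>

definition alexandroff :: "'a set \<Rightarrow> ('a \<Rightarrow> 'a \<Rightarrow> bool) \<Rightarrow> 'a topology" where
  "alexandroff P leq =
     topology (arbitrary union_of (\<lambda>U. \<exists>x\<in>P. U = {y \<in> P. leq y x}))"

lemma openin_alexandroff:
  assumes "reflp_on P leq" and "transp_on P leq"
  shows "openin (alexandroff P leq) U \<longleftrightarrow> U \<subseteq> P \<and> (\<forall>x\<in>U. \<forall>y\<in>P. leq y x \<longrightarrow> y \<in> U)"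
proof -
  let ?B = "\<lambda>U. \<exists>x\<in>P. U = {y \<in> P. leq y x}"
  have eq: "(arbitrary union_of ?B) U \<longleftrightarrow> U \<subseteq> P \<and> (\<forall>x\<in>U. \<forall>y\<in>P. leq y x \<longrightarrow> y \<in> U)" for U
  proof
    assume "(arbitrary union_of ?B) U"
    then obtain W where W: "W \<subseteq> Collect ?B" "\<Union>W = U"
      by (auto simp: union_of_def arbitrary_def)
    have "y \<in> U" if xy: "x \<in> U" "y \<in> P" "leq y x" for x y
    proof -
      obtain V where V: "V \<in> W" "x \<in> V" using xy W by blast
      then obtain z where z: "z \<in> P" "V = {y \<in> P. leq y z}" using W by blast
      then have "leq y z" using assms(2) V xy unfolding transp_on_def by blast
      then show ?thesis using V z W xy by blast
    qed
    moreover have "U \<subseteq> P" using W by auto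
    ultimately show "U \<subseteq> P \<and> (\<forall>x\<in>U. \<forall>y\<in>P. leq y x \<longrightarrow> y \<in> U)" by blast
  next
    assume U: "U \<subseteq> P \<and> (\<forall>x\<in>U. \<forall>y\<in>P. leq y x \<longrightarrow> y \<in> U)"
    have "\<Union>((\<lambda>x. {y \<in> P. leq y x}) ` U) = U"
      using U assms(1) by (auto simp: reflp_on_def)
    moreover have "(\<lambda>x. {y \<in> P. leq y x}) ` U \<subseteq> Collect ?B" using U by auto
    ultimately show "(arbitrary union_of ?B) U"
      unfolding union_of_def arbitrary_def by blast
  qed
  have "istopology (arbitrary union_of ?B)"
    unfolding istopology_base_alt unfolding eq by blast
  then show ?thesis
    by (simp add: alexandroff_def topology_inverse' eq)
qed

text \<open>
  An open set \<open>U\<close> is itself the carrier of a subposet; \<open>F\<close> also denotes its restriction to \<open>U\<close>.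
\<close>

definition hat_obj :: "('a \<Rightarrow> 'a \<Rightarrow> bool) \<Rightarrow> ('a, unit, 'u monoid, 'u \<Rightarrow> 'u) cfunctor \<Rightarrow>
    ('a set, unit, 'u monoid, 'u \<Rightarrow> 'u) cfunctor" where
  "hat_obj leq F =
     \<lparr>omap = (\<lambda>U. Ab_colim (poset_cat U leq) F),
      mmap = (\<lambda>U V m. induced_map (poset_cat U leq) F
                (Ab_colim (poset_cat U leq) F) (Ab_colim_in (poset_cat U leq) F)
                (Ab_colim (poset_cat V leq) F) (Ab_colim_in (poset_cat V leq) F))\<rparr>"

definition hat :: "'a set \<Rightarrow> ('a \<Rightarrow> 'a \<Rightarrow> bool) \<Rightarrow>
    (('a, unit, 'u monoid, 'u \<Rightarrow> 'u) cfunctor, 'a \<Rightarrow> 'u \<Rightarrow> 'u,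
     ('a set, unit, 'u monoid, 'u \<Rightarrow> 'u) cfunctor, 'a set \<Rightarrow> 'u \<Rightarrow> 'u) cfunctor" where
  "hat P leq =
     \<lparr>omap = hat_obj leq,
      mmap = (\<lambda>F G \<eta>. \<lambda>U\<in>{U. openin (alexandroff P leq) U}.
                induced_map (poset_cat U leq) F
                  (Ab_colim (poset_cat U leq) F) (Ab_colim_in (poset_cat U leq) F)
                  (Ab_colim (poset_cat U leq) G) (\<lambda>x a. Ab_colim_in (poset_cat U leq) G x (\<eta> x a)))\<rparr>"

end

theory Submission
  imports Defs
begin

text \<open>
  The quasi-inverse sends a cosheaf \<open>G\<close> to \<open>x \<mapsto> G (down x)\<close>, where \<open>down x\<close> is the least open set
  containing \<open>x\<close>.  The unit \<open>F x \<rightarrow> colim F\<close> over \<open>down x\<close> is an isomorphism because \<open>x\<close> is the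
  greatest element of \<open>down x\<close>.  For the counit at \<open>U\<close>, apply the cosheaf condition to the cover of
  \<open>U\<close> by the sets \<open>down x\<close>: every finite intersection in its nerve is covered by such sets as well,
  so homomorphisms out of \<open>G U\<close> are determined, and can be built, on the groups \<open>G (down x)\<close>.
\<close>

section \<open>Natural isomorphisms and functor categories\<close>

text \<open>An intersection of minimal open sets is in general not minimal, so the nerve of the
  cover of \<open>U\<close> by the sets \<open>down x\<close> carries groups that do not occur in
  the colimit over \<open>U\<close>, and the two diagrams cannot simply be matched. The inverse of
  the counit is therefore an explicit map out of the nerve colimit, built on a choice of one
  \<open>down x\<close> in each member of the nerve. The cosheaf condition enters twice: for
  \<open>U\<close>, to replace \<open>G U\<close> by the nerve colimit, and for each intersection,
  to show that the choice is immaterial. A second obstacle is typing: nerve colimits consist of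
  cosets and live in a larger type, whereas the values of the cosheaf attached to \<open>F\<close>
  must lie in the universe \<open>'u\<close>. Both are handled through the universal property, with
  the element type of the test group as a parameter, and composites are compared by evaluating them
  on coprojections.\<close>

lemma category_comp_in:
  "\<lbrakk>is_category C; A \<in> Obj C; B \<in> Obj C; D \<in> Obj C; f \<in> Hom C A B; g \<in> Hom C B D\<rbrakk>
   \<Longrightarrow> Comp C A B D g f \<in> Hom C A D"
  unfolding is_category_def by blast

lemma category_id_in: "\<lbrakk>is_category C; A \<in> Obj C\<rbrakk> \<Longrightarrow> Ident C A \<in> Hom C A A"
  unfolding is_category_def by blast

lemma category_id_right:
  "\<lbrakk>is_category C; A \<in> Obj C; B \<in> Obj C; f \<in> Hom C A B\<rbrakk> \<Longrightarrow> Comp C A A B f (Ident C A) = f"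
  unfolding is_category_def by blast

lemma category_id_left:
  "\<lbrakk>is_category C; A \<in> Obj C; B \<in> Obj C; f \<in> Hom C A B\<rbrakk> \<Longrightarrow> Comp C A B B (Ident C B) f = f"
  unfolding is_category_def by blast

lemma category_assoc:
  "\<lbrakk>is_category C; A \<in> Obj C; B \<in> Obj C; D \<in> Obj C; E \<in> Obj C;
    f \<in> Hom C A B; g \<in> Hom C B D; h \<in> Hom C D E\<rbrakk>
   \<Longrightarrow> Comp C A D E h (Comp C A B D g f) = Comp C A B E (Comp C B D E h g) f"
  unfolding is_category_def by blast

lemma functor_obj: "\<lbrakk>is_functor C D F; A \<in> Obj C\<rbrakk> \<Longrightarrow> omap F A \<in> Obj D"
  unfolding is_functor_def by blast

lemma functor_hom:
  "\<lbrakk>is_functor C D F; A \<in> Obj C; B \<in> Obj C; f \<in> Hom C A B\<rbrakk>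
   \<Longrightarrow> mmap F A B f \<in> Hom D (omap F A) (omap F B)"
  unfolding is_functor_def by blast

lemma functor_id:
  "\<lbrakk>is_functor C D F; A \<in> Obj C\<rbrakk> \<Longrightarrow> mmap F A A (Ident C A) = Ident D (omap F A)"
  unfolding is_functor_def by blast

lemma functor_comp:
  "\<lbrakk>is_functor C D F; A \<in> Obj C; B \<in> Obj C; E \<in> Obj C; f \<in> Hom C A B; g \<in> Hom C B E\<rbrakk> \<Longrightarrow>
     mmap F A E (Comp C A B E g f) =
     Comp D (omap F A) (omap F B) (omap F E) (mmap F B E g) (mmap F A B f)"
  unfolding is_functor_def by blast

lemma natural_component:
  "\<lbrakk>is_natural C D F G \<eta>; A \<in> Obj C\<rbrakk> \<Longrightarrow> \<eta> A \<in> Hom D (omap F A) (omap G A)"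
  unfolding is_natural_def by (auto simp: PiE_iff)

lemma natural_square:
  "\<lbrakk>is_natural C D F G \<eta>; A \<in> Obj C; B \<in> Obj C; f \<in> Hom C A B\<rbrakk> \<Longrightarrow>
     Comp D (omap F A) (omap F B) (omap G B) (\<eta> B) (mmap F A B f) =
     Comp D (omap F A) (omap G A) (omap G B) (mmap G A B f) (\<eta> A)"
  unfolding is_natural_def by blast

text \<open>The \<open>PiE\<close> in \<open>is_natural\<close> fixes the values outside
  \<open>Obj C\<close>, so agreement on objects is enough for equality of transformations.\<close>

lemma natural_eqI:
  assumes "is_natural C D F G \<eta>" "is_natural C D F' G' \<theta>" "\<And>A. A \<in> Obj C \<Longrightarrow> \<eta> A = \<theta> A"
  shows "\<eta> = \<theta>"
proof (rule extensionalityI[of _ "Obj C"])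
  show "\<eta> \<in> extensional (Obj C)" "\<theta> \<in> extensional (Obj C)"
    using assms(1,2) by (auto simp: is_natural_def PiE_def)
qed (rule assms(3))

lemma natural_id:
  assumes "is_functor C D F"
  shows "is_natural C D F F (\<lambda>A\<in>Obj C. Ident D (omap F A))"
  using assms unfolding is_functor_def is_natural_def
  by (auto simp: PiE_iff category_id_in category_id_left category_id_right)

text \<open>The squares of \<alpha> and \<beta> are pasted along \<open>mmap G A B f\<close>;
  everything else is reassociation.\<close>

lemma natural_comp:
  assumes F: "is_functor C D F" and G: "is_functor C D G" and H: "is_functor C D H"
    and \<alpha>: "is_natural C D F G \<alpha>" and \<beta>: "is_natural C D G H \<beta>"
  shows "is_natural C D F H
           (\<lambda>A\<in>Obj C. Comp D (omap F A) (omap G A) (omap H A) (\<beta> A) (\<alpha> A))"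
  unfolding is_natural_def
proof (intro conjI ballI)
  have D: "is_category D" using F by (simp add: is_functor_def)
  note o = functor_obj[OF F] functor_obj[OF G] functor_obj[OF H]
  note m = functor_hom[OF F] functor_hom[OF G] functor_hom[OF H]
    natural_component[OF \<alpha>] natural_component[OF \<beta>]
  show "(\<lambda>A\<in>Obj C. Comp D (omap F A) (omap G A) (omap H A) (\<beta> A) (\<alpha> A))
      \<in> (\<Pi>\<^sub>E A\<in>Obj C. Hom D (omap F A) (omap H A))"
    by (auto intro!: category_comp_in[OF D] o m)
  fix A B f assume A: "A \<in> Obj C" and B: "B \<in> Obj C" and f: "f \<in> Hom C A B"
  let ?c = "\<lambda>X Y Z. Comp D X Y Z"
  have "?c (omap F A) (omap F B) (omap H B) (?c (omap F B) (omap G B) (omap H B) (\<beta> B) (\<alpha> B)) (mmap F A B f)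
      = ?c (omap F A) (omap G B) (omap H B) (\<beta> B)
          (?c (omap F A) (omap F B) (omap G B) (\<alpha> B) (mmap F A B f))"
    by (rule category_assoc[OF D, symmetric]) (use A B f o m in auto)
  also have "\<dots> = ?c (omap F A) (omap G B) (omap H B) (\<beta> B)
          (?c (omap F A) (omap G A) (omap G B) (mmap G A B f) (\<alpha> A))"
    using natural_square[OF \<alpha> A B f] by simp
  also have "\<dots> = ?c (omap F A) (omap G A) (omap H B)
          (?c (omap G A) (omap G B) (omap H B) (\<beta> B) (mmap G A B f)) (\<alpha> A)"
    by (rule category_assoc[OF D]) (use A B f o m in auto)
  also have "\<dots> = ?c (omap F A) (omap G A) (omap H B)
          (?c (omap G A) (omap H A) (omap H B) (mmap H A B f) (\<beta> A)) (\<alpha> A)"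
    using natural_square[OF \<beta> A B f] by simp
  also have "\<dots> = ?c (omap F A) (omap H A) (omap H B) (mmap H A B f)
          (?c (omap F A) (omap G A) (omap H A) (\<beta> A) (\<alpha> A))"
    by (rule category_assoc[OF D, symmetric]) (use A B f o m in auto)
  finally show "?c (omap F A) (omap F B) (omap H B)
        ((\<lambda>A\<in>Obj C. ?c (omap F A) (omap G A) (omap H A) (\<beta> A) (\<alpha> A)) B) (mmap F A B f) =
      ?c (omap F A) (omap H A) (omap H B) (mmap H A B f)
        ((\<lambda>A\<in>Obj C. ?c (omap F A) (omap G A) (omap H A) (\<beta> A) (\<alpha> A)) A)"
    using A B by simp
qed

text \<open>The laws of \<open>D\<close> come from the objects themselves: \<open>is_functor\<close>
  contains \<open>is_category D\<close>, so every law can be derived from the functors that it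
  mentions.\<close>

lemma category_functor_cat: "is_category (functor_cat C D)"
  unfolding is_category_def
proof (intro conjI ballI, goal_cases)
  case (1 F)
  then show ?case by (simp add: functor_cat_def natural_id)
next
  case (2 F G H \<alpha> \<beta>)
  then show ?case by (simp add: functor_cat_def natural_comp)
next
  case (3 F G \<alpha>)
  then have h: "is_functor C D F" "is_functor C D G" "is_natural C D F G \<alpha>" "is_category D"
    by (auto simp: functor_cat_def is_functor_def)
  show ?case
    by (rule natural_eqI[OF _ h(3)])
       (use natural_comp[OF h(1,1,2) natural_id[OF h(1)] h(3)] in
        \<open>auto simp: functor_cat_def intro!: category_id_right h functor_obj[OF h(1)]
           functor_obj[OF h(2)] natural_component[OF h(3)]\<close>)
next
  case (4 F G \<alpha>)
  then have h: "is_functor C D F" "is_functor C D G" "is_natural C D F G \<alpha>" "is_category D"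
    by (auto simp: functor_cat_def is_functor_def)
  show ?case
    by (rule natural_eqI[OF _ h(3)])
       (use natural_comp[OF h(1,2,2,3) natural_id[OF h(2)]] in
        \<open>auto simp: functor_cat_def intro!: category_id_left h functor_obj[OF h(1)]
           functor_obj[OF h(2)] natural_component[OF h(3)]\<close>)
next
  case (5 F G H K \<alpha> \<beta> \<gamma>)
  then have f: "is_functor C D F" "is_functor C D G" "is_functor C D H" "is_functor C D K"
    and D: "is_category D"
    and n: "is_natural C D F G \<alpha>" "is_natural C D G H \<beta>" "is_natural C D H K \<gamma>"
    by (auto simp: functor_cat_def is_functor_def)
  note o = functor_obj[OF f(1)] functor_obj[OF f(2)] functor_obj[OF f(3)] functor_obj[OF f(4)]
  note m = natural_component[OF n(1)] natural_component[OF n(2)] natural_component[OF n(3)]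
  show ?case
    by (auto simp: functor_cat_def intro!: restrict_ext category_assoc[OF D] o m)
qed

text \<open>For \<open>Cosh\<close>, which differs from a functor category only in its set of
  objects.\<close>

lemma category_full_subcategory:
  assumes "is_category C" "S \<subseteq> Obj C"
  shows "is_category (C\<lparr>Obj := S\<rparr>)"
proof -
  have i: "A \<in> S \<Longrightarrow> A \<in> Obj C" for A using assms(2) by blast
  show ?thesis
    using assms(1) unfolding is_category_def by (simp add: i)
qed

text \<open>Pointwise inverses of a natural transformation are automatically natural: conjugating
  the square of \<eta> by the inverses turns it into the square of the inverse family.\<close>

lemma functor_cat_isoI:
  assumes F: "is_functor C D F" and G: "is_functor C D G" and \<eta>: "is_natural C D F G \<eta>"
    and iso: "\<And>A. A \<in> Obj C \<Longrightarrow> is_isomorphism D (omap F A) (omap G A) (\<eta> A)"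
  shows "is_isomorphism (functor_cat C D) F G \<eta>"
proof -
  have D: "is_category D" using F by (simp add: is_functor_def)
  have "\<forall>A\<in>Obj C. \<exists>g. g \<in> Hom D (omap G A) (omap F A) \<and>
      Comp D (omap F A) (omap G A) (omap F A) g (\<eta> A) = Ident D (omap F A) \<and>
      Comp D (omap G A) (omap F A) (omap G A) (\<eta> A) g = Ident D (omap G A)"
    using iso unfolding is_isomorphism_def by blast
  then obtain \<theta>' where \<theta>': "\<forall>A\<in>Obj C. \<theta>' A \<in> Hom D (omap G A) (omap F A) \<and>
      Comp D (omap F A) (omap G A) (omap F A) (\<theta>' A) (\<eta> A) = Ident D (omap F A) \<and>
      Comp D (omap G A) (omap F A) (omap G A) (\<eta> A) (\<theta>' A) = Ident D (omap G A)"
    by metis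
  \<comment> \<open>The inverses come from a choice at each object; restriction makes the family
    extensional, as \<open>is_natural\<close> demands.\<close>
  define \<theta> where "\<theta> = restrict \<theta>' (Obj C)"
  have \<theta>: "\<theta> A \<in> Hom D (omap G A) (omap F A)"
    "Comp D (omap F A) (omap G A) (omap F A) (\<theta> A) (\<eta> A) = Ident D (omap F A)"
    "Comp D (omap G A) (omap F A) (omap G A) (\<eta> A) (\<theta> A) = Ident D (omap G A)"
    if "A \<in> Obj C" for A
    using \<theta>' that by (auto simp: \<theta>_def)
  note o = functor_obj[OF F] functor_obj[OF G]
  note m = functor_hom[OF F] functor_hom[OF G] natural_component[OF \<eta>] \<theta>(1)
  have nat: "is_natural C D G F \<theta>"
    unfolding is_natural_def
  proof (intro conjI ballI)
    show "\<theta> \<in> (\<Pi>\<^sub>E A\<in>Obj C. Hom D (omap G A) (omap F A))"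
      using \<theta>(1) by (auto simp: \<theta>_def)
    fix A B f assume A: "A \<in> Obj C" and B: "B \<in> Obj C" and f: "f \<in> Hom C A B"
    let ?c = "\<lambda>X Y Z. Comp D X Y Z"
    \<comment> \<open>Insert \<open>\<eta> A\<close> after \<open>\<theta> A\<close> on the right,
      move \<eta> across by its square, and cancel \<open>\<theta> B\<close> against
      \<open>\<eta> B\<close> on the left.\<close>
    have "?c (omap G A) (omap G B) (omap F B) (\<theta> B) (mmap G A B f)
        = ?c (omap G A) (omap G B) (omap F B) (\<theta> B)
            (?c (omap G A) (omap G A) (omap G B) (mmap G A B f)
              (?c (omap G A) (omap F A) (omap G A) (\<eta> A) (\<theta> A)))"
      using \<theta>(3)[OF A] category_id_right[OF D] o m A B f by simp
    also have "?c (omap G A) (omap G A) (omap G B) (mmap G A B f)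
              (?c (omap G A) (omap F A) (omap G A) (\<eta> A) (\<theta> A))
        = ?c (omap G A) (omap F A) (omap G B)
            (?c (omap F A) (omap G A) (omap G B) (mmap G A B f) (\<eta> A)) (\<theta> A)"
      by (rule category_assoc[OF D]) (use A B f o m in auto)
    also have "\<dots> = ?c (omap G A) (omap F A) (omap G B)
            (?c (omap F A) (omap F B) (omap G B) (\<eta> B) (mmap F A B f)) (\<theta> A)"
      using natural_square[OF \<eta> A B f] by simp
    also have "\<dots> = ?c (omap G A) (omap F B) (omap G B) (\<eta> B)
            (?c (omap G A) (omap F A) (omap F B) (mmap F A B f) (\<theta> A))"
      by (rule category_assoc[OF D, symmetric]) (use A B f o m in auto)
    also have "?c (omap G A) (omap G B) (omap F B) (\<theta> B) \<dots>
        = ?c (omap G A) (omap F B) (omap F B) (?c (omap F B) (omap G B) (omap F B) (\<theta> B) (\<eta> B))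
            (?c (omap G A) (omap F A) (omap F B) (mmap F A B f) (\<theta> A))"
      by (rule category_assoc[OF D])
         (use A B f o m in \<open>auto intro!: category_comp_in[OF D]\<close>)
    also have "\<dots> = ?c (omap G A) (omap F A) (omap F B) (mmap F A B f) (\<theta> A)"
      unfolding \<theta>(2)[OF B]
      by (rule category_id_left[OF D]) (use A B f o m in \<open>auto intro!: category_comp_in[OF D]\<close>)
    finally show "?c (omap G A) (omap G B) (omap F B) (\<theta> B) (mmap G A B f)
        = ?c (omap G A) (omap F A) (omap F B) (mmap F A B f) (\<theta> A)" .
  qed
  show ?thesis
    unfolding is_isomorphism_def
  proof (intro conjI bexI[of _ \<theta>])
    show "\<theta> \<in> Hom (functor_cat C D) G F" using nat by (simp add: functor_cat_def)
  qed (use \<eta> \<theta> in \<open>auto simp: functor_cat_def\<close>)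
qed

section \<open>The category of abelian groups\<close>

lemma Ab_simps [simp]:
  "G \<in> Obj Ab \<longleftrightarrow> comm_group G"
  "f \<in> Hom Ab G H \<longleftrightarrow> f \<in> hom G H \<and> f \<in> extensional (carrier G)"
  "Ident Ab G = (\<lambda>x\<in>carrier G. x)"
  "Comp Ab G H K g f = compose (carrier G) g f"
  by (simp_all add: Ab_def)

lemma comm_group_imp_group: "comm_group G \<Longrightarrow> group G"
  by (rule comm_group.axioms(2))

text \<open>Arrows of \<open>Ab\<close> are extensional, so maps are constantly exchanged for their
  restrictions to the carrier; this carries the homomorphism property across.\<close>

lemma hom_cong:
  assumes "comm_group G" and "f \<in> hom G H" and "\<And>x. x \<in> carrier G \<Longrightarrow> f x = g x"
  shows "g \<in> hom G H"
  using group.hom_restrict[OF comm_group_imp_group] assms by blast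

lemma hom_compose_Ab:
  assumes "comm_group G" and "f \<in> hom G H" and "g \<in> hom H K"
  shows "compose (carrier G) g f \<in> hom G K"
  by (rule hom_cong[OF assms(1) hom_compose[OF assms(2,3)]]) (simp add: compose_def)

lemma category_Ab: "is_category Ab"
  unfolding is_category_def
proof (intro conjI ballI, goal_cases)
  case (1 G)
  moreover have "(\<lambda>x. x) \<in> hom G G" by (simp add: hom_def)
  ultimately have "(\<lambda>x\<in>carrier G. x) \<in> hom G G" by (auto elim: hom_cong[rotated])
  then show ?case by simp
next
  case (2 G H K f g)
  then show ?case by (auto intro: hom_compose_Ab)
next
  case (3 G H f)
  then show ?case by (auto simp: compose_def extensional_def)
next
  case (4 G H f)
  then show ?case by (auto simp: compose_def extensional_def hom_in_carrier)
next
  case (5 G H K L f g h)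
  then show ?case by (auto simp: compose_def hom_in_carrier)
qed

lemma Ab_isoI:
  assumes "comm_group G" and "comm_group H"
    and "f \<in> iso G H" and "f \<in> extensional (carrier G)"
  shows "is_isomorphism Ab G H f"
proof -
  obtain g where g: "group_isomorphisms G H f g"
    using group.iso_iff_group_isomorphisms[OF comm_group_imp_group[OF assms(1)]] assms(3) by blast
  then have fg: "f \<in> hom G H" "g \<in> hom H G"
    "\<And>x. x \<in> carrier G \<Longrightarrow> g (f x) = x" "\<And>y. y \<in> carrier H \<Longrightarrow> f (g y) = y"
    by (auto simp: group_isomorphisms_def)
  \<comment> \<open>The inverse function is arbitrary off the carrier and becomes an arrow of
    \<open>Ab\<close> only after restriction.\<close>
  have "restrict g (carrier H) \<in> hom H G"
    by (rule hom_cong[OF assms(2) fg(2)]) simp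
  then show ?thesis
    unfolding is_isomorphism_def using assms(4) fg
    by (intro conjI bexI[of _ "restrict g (carrier H)"])
       (auto simp: compose_def hom_in_carrier)
qed

lemma hom_iso_byWitness:
  assumes "f \<in> hom G H" and "g \<in> hom H G"
    and "\<And>x. x \<in> carrier G \<Longrightarrow> g (f x) = x" and "\<And>y. y \<in> carrier H \<Longrightarrow> f (g y) = y"
  shows "f \<in> iso G H"
proof -
  have "bij_betw f (carrier G) (carrier H)"
    by (rule bij_betw_byWitness[of _ g]) (use assms in \<open>auto intro: hom_in_carrier\<close>)
  then show ?thesis using assms(1) by (simp add: iso_def)
qed

section \<open>Posets as categories\<close>

lemma poset_cat_simps [simp]:
  "Obj (poset_cat P leq) = P"
  "m \<in> Hom (poset_cat P leq) x y \<longleftrightarrow> leq x y"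
  "Ident (poset_cat P leq) x = ()"
  "Comp (poset_cat P leq) x y z g f = ()"
  by (simp_all add: poset_cat_def)

lemma category_poset_cat:
  assumes "reflp_on P leq" and "transp_on P leq"
  shows "is_category (poset_cat P leq)"
  unfolding is_category_def
  using assms by (auto dest: reflp_onD transp_onD)

section \<open>Colimits of abelian groups\<close>

text \<open>The element type \<open>'b\<close> of the vertex is independent of the universe
  \<open>'u\<close> of the diagram, so groups of cosets can serve as vertices too.\<close>

definition cocone :: "('j, 'm) category \<Rightarrow> ('j, 'm, 'u monoid, 'u \<Rightarrow> 'u) cfunctor \<Rightarrow>
    'b monoid \<Rightarrow> ('j \<Rightarrow> 'u \<Rightarrow> 'b) \<Rightarrow> bool" where
  "cocone J F A \<phi> \<longleftrightarrow> comm_group A \<and> (\<forall>j\<in>Obj J. \<phi> j \<in> hom (omap F j) A) \<and>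
     (\<forall>j\<in>Obj J. \<forall>k\<in>Obj J. \<forall>m\<in>Hom J j k. \<forall>a\<in>carrier (omap F j). \<phi> k (mmap F j k m a) = \<phi> j a)"

text \<open>
  A proposition cannot quantify over types, so the type \<open>'b\<close> of the elements of the test groups
  is a parameter.
\<close>

definition is_colimit :: "'b itself \<Rightarrow> ('j, 'm) category \<Rightarrow>
    ('j, 'm, 'u monoid, 'u \<Rightarrow> 'u) cfunctor \<Rightarrow> 'l monoid \<Rightarrow> ('j \<Rightarrow> 'u \<Rightarrow> 'l) \<Rightarrow> bool" where
  "is_colimit T J F L \<iota> \<longleftrightarrow> cocone J F L \<iota> \<and>
     (\<forall>(A :: 'b monoid) \<phi>. cocone J F A \<phi> \<longrightarrow>
        (\<exists>!h. h \<in> hom L A \<inter> extensional (carrier L) \<and>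
              (\<forall>j\<in>Obj J. \<forall>a\<in>carrier (omap F j). h (\<iota> j a) = \<phi> j a)))"

lemma coconeI:
  assumes "comm_group A" and "\<And>j. j \<in> Obj J \<Longrightarrow> \<phi> j \<in> hom (omap F j) A"
    and "\<And>j k m a. \<lbrakk>j \<in> Obj J; k \<in> Obj J; m \<in> Hom J j k; a \<in> carrier (omap F j)\<rbrakk>
           \<Longrightarrow> \<phi> k (mmap F j k m a) = \<phi> j a"
  shows "cocone J F A \<phi>"
  using assms unfolding cocone_def by blast

lemma cocone_comm_group: "cocone J F A \<phi> \<Longrightarrow> comm_group A"
  by (simp add: cocone_def)

lemma cocone_hom: "cocone J F A \<phi> \<Longrightarrow> j \<in> Obj J \<Longrightarrow> \<phi> j \<in> hom (omap F j) A"
  by (simp add: cocone_def)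

lemma cocone_commute:
  "\<lbrakk>cocone J F A \<phi>; j \<in> Obj J; k \<in> Obj J; m \<in> Hom J j k; a \<in> carrier (omap F j)\<rbrakk>
   \<Longrightarrow> \<phi> k (mmap F j k m a) = \<phi> j a"
  by (simp add: cocone_def)

lemma cocone_compose:
  assumes "cocone J F A \<phi>" and "comm_group B" and "h \<in> hom A B"
  shows "cocone J F B (\<lambda>j a. h (\<phi> j a))"
  using assms hom_compose[of _ _ A h B] unfolding cocone_def o_def by auto

lemma colimit_cocone: "is_colimit T J F L \<iota> \<Longrightarrow> cocone J F L \<iota>"
  by (simp add: is_colimit_def)

text \<open>\<open>induced_map\<close> is a definite description, so all its properties rest on
  unique existence, taken from \<open>is_colimit\<close> at the element type of the target
  \<open>A\<close>.\<close>

lemma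
  fixes A :: "'b monoid"
  assumes "is_colimit TYPE('b) J F L \<iota>" and "cocone J F A \<phi>"
  shows induced_map_hom: "induced_map J F L \<iota> A \<phi> \<in> hom L A"
    and induced_map_extensional: "induced_map J F L \<iota> A \<phi> \<in> extensional (carrier L)"
    and induced_map_apply:
      "\<And>j a. \<lbrakk>j \<in> Obj J; a \<in> carrier (omap F j)\<rbrakk> \<Longrightarrow> induced_map J F L \<iota> A \<phi> (\<iota> j a) = \<phi> j a"
proof -
  have "\<exists>!h. h \<in> hom L A \<inter> extensional (carrier L) \<and>
              (\<forall>j\<in>Obj J. \<forall>a\<in>carrier (omap F j). h (\<iota> j a) = \<phi> j a)"
    using assms unfolding is_colimit_def by blast
  from theI'[OF this, folded induced_map_def]
  show "induced_map J F L \<iota> A \<phi> \<in> hom L A"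
    "induced_map J F L \<iota> A \<phi> \<in> extensional (carrier L)"
    "\<And>j a. \<lbrakk>j \<in> Obj J; a \<in> carrier (omap F j)\<rbrakk> \<Longrightarrow> induced_map J F L \<iota> A \<phi> (\<iota> j a) = \<phi> j a"
    by auto
qed

text \<open>Restricted to the carrier of \<open>L\<close>, both maps solve the universal problem for
  the cocone \<open>h (\<iota> j a)\<close>, and that problem has one solution. This is how
  identities between composites are checked later on.\<close>

lemma colimit_hom_eqI:
  fixes A :: "'b monoid"
  assumes L: "is_colimit TYPE('b) J F L \<iota>" and A: "comm_group A"
    and h: "h \<in> hom L A" and k: "k \<in> hom L A"
    and eq: "\<And>j a. \<lbrakk>j \<in> Obj J; a \<in> carrier (omap F j)\<rbrakk> \<Longrightarrow> h (\<iota> j a) = k (\<iota> j a)"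
    and x: "x \<in> carrier L"
  shows "h x = k x"
proof -
  note \<iota> = colimit_cocone[OF L]
  note cL = cocone_comm_group[OF \<iota>]
  have \<iota>c: "\<iota> j a \<in> carrier L" if "j \<in> Obj J" "a \<in> carrier (omap F j)" for j a
    using cocone_hom[OF \<iota> that(1)] that(2) by (rule hom_in_carrier)
  let ?P = "\<lambda>g. g \<in> hom L A \<inter> extensional (carrier L) \<and>
              (\<forall>j\<in>Obj J. \<forall>a\<in>carrier (omap F j). g (\<iota> j a) = h (\<iota> j a))"
  have "\<exists>!g. ?P g"
    using L cocone_compose[OF \<iota> A h] unfolding is_colimit_def by blast
  moreover have "?P (restrict h (carrier L))"
    using \<iota>c hom_cong[OF cL h, of "restrict h (carrier L)"] by simp
  moreover have "?P (restrict k (carrier L))"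
    using \<iota>c eq hom_cong[OF cL k, of "restrict k (carrier L)"] by simp
  ultimately have "restrict h (carrier L) = restrict k (carrier L)" by blast
  then show ?thesis using x by (metis restrict_apply')
qed

lemma functor_Ab_comm_group: "is_functor J Ab F \<Longrightarrow> j \<in> Obj J \<Longrightarrow> comm_group (omap F j)"
  using functor_obj by fastforce

lemma functor_Ab_hom:
  "\<lbrakk>is_functor J Ab F; j \<in> Obj J; k \<in> Obj J; m \<in> Hom J j k\<rbrakk>
   \<Longrightarrow> mmap F j k m \<in> hom (omap F j) (omap F k)"
  using functor_hom by fastforce

lemma functor_Ab_extensional:
  "\<lbrakk>is_functor J Ab F; j \<in> Obj J; k \<in> Obj J; m \<in> Hom J j k\<rbrakk>
   \<Longrightarrow> mmap F j k m \<in> extensional (carrier (omap F j))"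
  using functor_hom by fastforce

text \<open>\<open>colim_group_universal\<close> provides the mediating maps; what remains for a
  colimit is that the coprojections are compatible homomorphisms into an abelian group.\<close>

lemma cocone_colim_in:
  assumes F: "is_functor J Ab F"
  shows "cocone J F (colim_group J F) (colim_in J F)"
proof -
  define I where "I = Obj J"
  define G where "G = omap F"
  define S where "S = sum_group I G"
  define N where "N = colim_subgroup J F"
  have cg: "comm_group (G i)" if "i \<in> I" for i
    using functor_Ab_comm_group[OF F] that by (simp add: G_def I_def)
  have gr: "group (G i)" if "i \<in> I" for i using cg[OF that] by (rule comm_group_imp_group)
  have one: "\<one>\<^bsub>G i\<^esub> \<in> carrier (G i)" if "i \<in> I" for i
    using gr[OF that] by (simp add: group.is_monoid)
  have mor: "mmap F j k m a \<in> carrier (G k)"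
    if "j \<in> I" "k \<in> I" "m \<in> Hom J j k" "a \<in> carrier (G j)" for j k m a
    using functor_Ab_hom[OF F] that unfolding I_def G_def by (blast intro: hom_in_carrier)
  have cS: "carrier S = {x \<in> \<Pi>\<^sub>E i\<in>I. carrier (G i). finite {i \<in> I. x i \<noteq> \<one>\<^bsub>G i\<^esub>}}"
    unfolding S_def using gr by (rule carrier_sum_group)
  have mS: "x \<otimes>\<^bsub>S\<^esub> y = (\<lambda>i\<in>I. x i \<otimes>\<^bsub>G i\<^esub> y i)" for x y by (simp add: S_def)
  have gS: "group S" using gr by (simp add: S_def)
  \<comment> \<open>Commutativity of the direct sum makes the subgroup of relations normal and the
    quotient abelian.\<close>
  interpret S: comm_group S
  proof (rule group.group_comm_groupI[OF gS])
    fix x y assume "x \<in> carrier S" "y \<in> carrier S"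
    then show "x \<otimes>\<^bsub>S\<^esub> y = y \<otimes>\<^bsub>S\<^esub> x"
      unfolding mS cS
      by (intro restrict_ext) (auto intro!: comm_monoid.m_comm comm_group.axioms(1) cg)
  qed
  have si: "sum_in J F j a = (\<lambda>i\<in>I. if i = j then a else \<one>\<^bsub>G i\<^esub>)" for j a
    unfolding sum_in_def I_def G_def by (rule refl)
  have sin: "sum_in J F j a \<in> carrier S" if "j \<in> I" "a \<in> carrier (G j)" for j a
  proof -
    have "finite {i \<in> I. sum_in J F j a i \<noteq> \<one>\<^bsub>G i\<^esub>}"
      by (rule finite_subset[of _ "{j}"]) (auto simp: si)
    then show ?thesis using that one by (auto simp: cS si)
  qed
  have sinhom: "sum_in J F j \<in> hom (G j) S" if j: "j \<in> I" for j
  proof (rule homI)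
    fix a b assume "a \<in> carrier (G j)" "b \<in> carrier (G j)"
    then show "sum_in J F j (a \<otimes>\<^bsub>G j\<^esub> b) = sum_in J F j a \<otimes>\<^bsub>S\<^esub> sum_in J F j b"
      using gr unfolding mS si by (auto intro!: restrict_ext simp: group.is_monoid)
  qed (use sin j in auto)
  have R: "colim_relations J F = {sum_in J F k (mmap F j k m a) \<otimes>\<^bsub>S\<^esub> inv\<^bsub>S\<^esub> (sum_in J F j a) | j k m a.
      j \<in> I \<and> k \<in> I \<and> m \<in> Hom J j k \<and> a \<in> carrier (G j)}"
    by (simp add: colim_relations_def S_def I_def G_def)
  have relc: "colim_relations J F \<subseteq> carrier S"
    unfolding R using sin mor by auto
  have N: "N = generate S (colim_relations J F)"
    by (simp add: N_def colim_subgroup_def S_def I_def G_def)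
  have Nsub: "subgroup N S" unfolding N using relc by (rule S.generate_is_subgroup)
  have Nn: "N \<lhd> S" using Nsub by (rule S.subgroup_imp_normal)
  have C: "colim_group J F = S Mod N" "colim_in J F j = (\<lambda>a. N #>\<^bsub>S\<^esub> sum_in J F j a)" for j
    by (simp_all add: colim_group_def colim_in_def S_def N_def I_def G_def fun_eq_iff)
  show ?thesis
  proof (rule coconeI)
    show "comm_group (colim_group J F)"
      unfolding C using Nsub by (rule S.abelian_FactGroup)
  next
    fix j assume "j \<in> Obj J"
    then show "colim_in J F j \<in> hom (omap F j) (colim_group J F)"
      unfolding C using hom_compose[OF sinhom normal.r_coset_hom_Mod[OF Nn]]
      by (simp add: o_def I_def G_def)
  next
    fix j k m a
    assume h: "j \<in> Obj J" "k \<in> Obj J" "m \<in> Hom J j k" "a \<in> carrier (omap F j)"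
    let ?x = "sum_in J F k (mmap F j k m a)" and ?y = "sum_in J F j a"
    have x: "?x \<in> carrier S" and y: "?y \<in> carrier S"
      using h sin mor by (auto simp: I_def G_def)
    \<comment> \<open>The quotient of the two representatives is itself a generating relation, so
      their cosets coincide.\<close>
    have "?x \<otimes>\<^bsub>S\<^esub> inv\<^bsub>S\<^esub> ?y \<in> colim_relations J F"
      unfolding R using h unfolding I_def G_def by blast
    then have "?x \<otimes>\<^bsub>S\<^esub> inv\<^bsub>S\<^esub> ?y \<in> N" unfolding N by (rule generate.incl)
    then have "?x \<in> N #>\<^bsub>S\<^esub> ?y"
      using x y subgroup.rcos_module[OF Nsub gS y x] by simp
    then have "N #>\<^bsub>S\<^esub> ?y = N #>\<^bsub>S\<^esub> ?x"
      using S.repr_independence y Nsub by blast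
    then show "colim_in J F k (mmap F j k m a) = colim_in J F j a"
      unfolding C by simp
  qed
qed

text \<open>The type \<open>'b\<close> stays free, so the same colimit can be tested against groups
  in \<open>'u\<close> and against groups of cosets.\<close>

lemma colim_group_is_colimit:
  assumes F: "is_functor J Ab F"
  shows "is_colimit TYPE('b) J F (colim_group J F) (colim_in J F)"
  unfolding is_colimit_def
proof (intro conjI allI impI)
  fix A :: "'b monoid" and \<phi>
  assume "cocone J F A \<phi>"
  then show "\<exists>!h. h \<in> hom (colim_group J F) A \<inter> extensional (carrier (colim_group J F)) \<and>
              (\<forall>j\<in>Obj J. \<forall>a\<in>carrier (omap F j). h (colim_in J F j a) = \<phi> j a)"
    unfolding cocone_def by (intro colim_group_universal[OF F]) auto
qed (rule cocone_colim_in[OF F])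

text \<open>A map out of \<open>M\<close> is a map out of \<open>L\<close> preceded by the inverse
  \<open>d\<close> of \<open>e\<close>. This moves the universal property from the group of cosets
  to its copy inside the universe.\<close>

lemma is_colimit_iso:
  assumes L: "is_colimit TYPE('b) J F L \<iota>" and M: "comm_group M" and e: "e \<in> iso L M"
  shows "is_colimit TYPE('b) J F M (\<lambda>j a. e (\<iota> j a))"
proof -
  note \<iota> = colimit_cocone[OF L]
  note cL = cocone_comm_group[OF \<iota>]
  have eh: "e \<in> hom L M" using e by (simp add: iso_def)
  obtain d where d: "group_isomorphisms L M e d"
    using e group.iso_iff_group_isomorphisms[OF comm_group_imp_group[OF cL]] by blast
  then have dh: "d \<in> hom M L" and de: "\<And>x. x \<in> carrier L \<Longrightarrow> d (e x) = x"
    and ed: "\<And>y. y \<in> carrier M \<Longrightarrow> e (d y) = y"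
    by (auto simp: group_isomorphisms_def)
  have \<iota>c: "\<iota> j a \<in> carrier L" if "j \<in> Obj J" "a \<in> carrier (omap F j)" for j a
    using cocone_hom[OF \<iota> that(1)] that(2) by (rule hom_in_carrier)
  show ?thesis
    unfolding is_colimit_def
  proof (intro conjI allI impI)
    show "cocone J F M (\<lambda>j a. e (\<iota> j a))" by (rule cocone_compose[OF \<iota> M eh])
  next
    fix A :: "'b monoid" and \<phi>
    assume \<phi>: "cocone J F A \<phi>"
    note cA = cocone_comm_group[OF \<phi>]
    define h where "h = induced_map J F L \<iota> A \<phi>"
    have h: "h \<in> hom L A" "\<And>j a. \<lbrakk>j \<in> Obj J; a \<in> carrier (omap F j)\<rbrakk> \<Longrightarrow> h (\<iota> j a) = \<phi> j a"
      unfolding h_def using induced_map_hom[OF L \<phi>] induced_map_apply[OF L \<phi>] by auto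
    show "\<exists>!h. h \<in> hom M A \<inter> extensional (carrier M) \<and>
              (\<forall>j\<in>Obj J. \<forall>a\<in>carrier (omap F j). h (e (\<iota> j a)) = \<phi> j a)"
    proof (rule ex1I[of _ "\<lambda>y\<in>carrier M. h (d y)"], goal_cases)
      case 1
      have "(\<lambda>y\<in>carrier M. h (d y)) \<in> hom M A"
        by (rule hom_cong[OF M hom_compose[OF dh h(1)]]) simp
      then show ?case using h(2) \<iota>c de hom_in_carrier[OF eh] by auto
    next
      case (2 k)
      then have k: "k \<in> hom M A" by simp
      \<comment> \<open>A competitor \<open>k\<close> on \<open>M\<close> becomes, after composition
        with \<open>e\<close>, a competitor on \<open>L\<close>, where uniqueness is known.\<close>
      have "k (e x) = h x" if "x \<in> carrier L" for x
        using colimit_hom_eqI[OF L cA hom_compose[OF eh k] h(1) _ that] h(2) 2 by simp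
      then have "k y = h (d y)" if "y \<in> carrier M" for y
        using that ed hom_in_carrier[OF dh] by metis
      then show ?case using 2 by (auto intro!: extensionalityI[of _ "carrier M"])
    qed
  qed
qed

text \<open>\<open>image_group\<close> multiplies by pulling its operands back along
  \<open>f\<close>; injectivity on the carrier is what makes this the transported operation.\<close>

lemma image_group_comm_group_iso:
  fixes f :: "'a \<Rightarrow> 'b" and G :: "'a monoid"
  assumes G: "comm_group G" and f: "inj_on f (carrier G)"
  shows "comm_group (image_group f G)" and "f \<in> iso G (image_group f G)"
proof -
  interpret comm_group G by (fact G)
  have mult: "f x \<otimes>\<^bsub>image_group f G\<^esub> f y = f (x \<otimes>\<^bsub>G\<^esub> y)"
    if "x \<in> carrier G" "y \<in> carrier G" for x y
    using that f by (simp add: image_group_def)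
  show iso: "f \<in> iso G (image_group f G)"
    using f by (auto simp: iso_def bij_betw_def image_group_carrier hom_def mult)
  have "group (image_group f G)"
    using iso_imp_img_group[OF iso] by (simp add: image_group_def)
  then show "comm_group (image_group f G)"
    by (rule group.group_comm_groupI) (auto simp: image_group_carrier mult m_comm)
qed

text \<open>The two size hypotheses act through \<open>inj_on_colim_embed\<close>: they make the
  chosen map into \<open>'u\<close> injective, hence an isomorphism onto the transported
  group.\<close>

lemma Ab_colim_is_colimit:
  fixes F :: "('j, 'm, 'u monoid, 'u \<Rightarrow> 'u) cfunctor"
  assumes F: "is_functor J Ab F" and "infinite (UNIV :: 'u set)" and "Obj J \<lesssim> (UNIV :: 'u set)"
  shows "is_colimit TYPE('b) J F (Ab_colim J F) (Ab_colim_in J F)"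
proof -
  note C = colim_group_is_colimit[OF F]
  have "comm_group (colim_group J F)" using cocone_comm_group[OF colimit_cocone[OF C]] .
  from image_group_comm_group_iso[OF this inj_on_colim_embed[OF assms]]
  have "is_colimit TYPE('b) J F (Ab_colim J F)
      (\<lambda>j a. colim_embed J F (colim_in J F j a))"
    unfolding Ab_colim_def by (intro is_colimit_iso[OF C])
  then show ?thesis
    by (simp add: Ab_colim_in_def[abs_def])
qed

section \<open>Diagrams of abelian groups on posets\<close>

text \<open>All arrows of a poset category are \<open>()\<close>, so the functor laws become
  equations between elements, and extensionality turns these back into equations in
  \<open>Ab\<close>. Reflexivity and transitivity of \<open>r\<close> are recovered from the
  identities and composites of the category.\<close>

lemma poset_functorI:
  assumes "is_category (poset_cat Q r)"
    and "\<And>x. x \<in> Q \<Longrightarrow> comm_group (omap F x)"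
    and "\<And>x y. \<lbrakk>x \<in> Q; y \<in> Q; r x y\<rbrakk> \<Longrightarrow> mmap F x y () \<in> hom (omap F x) (omap F y)"
    and "\<And>x y. \<lbrakk>x \<in> Q; y \<in> Q; r x y\<rbrakk> \<Longrightarrow> mmap F x y () \<in> extensional (carrier (omap F x))"
    and "\<And>x a. \<lbrakk>x \<in> Q; a \<in> carrier (omap F x)\<rbrakk> \<Longrightarrow> mmap F x x () a = a"
    and "\<And>x y z a. \<lbrakk>x \<in> Q; y \<in> Q; z \<in> Q; r x y; r y z; a \<in> carrier (omap F x)\<rbrakk>
           \<Longrightarrow> mmap F y z () (mmap F x y () a) = mmap F x z () a"
  shows "is_functor (poset_cat Q r) Ab F"
proof -
  have refl: "r x x" if "x \<in> Q" for x
    using category_id_in[OF assms(1), of x] that by simp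
  have trans: "r x z" if "x \<in> Q" "y \<in> Q" "z \<in> Q" "r x y" "r y z" for x y z
    using category_comp_in[OF assms(1), of x y z "()" "()"] that by simp
  have "mmap F x x () = (\<lambda>a\<in>carrier (omap F x). a)" if x: "x \<in> Q" for x
  proof (rule extensionalityI[of _ "carrier (omap F x)"])
    show "mmap F x x () \<in> extensional (carrier (omap F x))"
      using assms(4)[OF x x refl[OF x]] .
  qed (simp_all add: assms(5)[OF x])
  moreover have "mmap F x z () = compose (carrier (omap F x)) (mmap F y z ()) (mmap F x y ())"
    if h: "x \<in> Q" "y \<in> Q" "z \<in> Q" "r x y" "r y z" for x y z
  proof (rule extensionalityI[of _ "carrier (omap F x)"])
    show "mmap F x z () \<in> extensional (carrier (omap F x))"
      using assms(4)[OF h(1,3) trans[OF h]] .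
  qed (simp_all add: compose_def assms(6)[OF h])
  ultimately show ?thesis
    unfolding is_functor_def
    by (intro conjI ballI) (simp_all add: assms(1,2,3,4) category_Ab)
qed

lemma poset_functor_hom:
  "\<lbrakk>is_functor (poset_cat Q r) Ab F; x \<in> Q; y \<in> Q; r x y\<rbrakk>
   \<Longrightarrow> mmap F x y () \<in> hom (omap F x) (omap F y)"
  using functor_Ab_hom[of "poset_cat Q r" F x y "()"] by simp

lemma poset_functor_extensional:
  "\<lbrakk>is_functor (poset_cat Q r) Ab F; x \<in> Q; y \<in> Q; r x y\<rbrakk>
   \<Longrightarrow> mmap F x y () \<in> extensional (carrier (omap F x))"
  using functor_Ab_extensional[of "poset_cat Q r" F x y "()"] by simp

lemma poset_functor_closed:
  "\<lbrakk>is_functor (poset_cat Q r) Ab F; x \<in> Q; y \<in> Q; r x y; a \<in> carrier (omap F x)\<rbrakk>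
   \<Longrightarrow> mmap F x y () a \<in> carrier (omap F y)"
  by (rule hom_in_carrier[OF poset_functor_hom])

lemma poset_functor_id:
  assumes "is_functor (poset_cat Q r) Ab F" and "x \<in> Q" and "a \<in> carrier (omap F x)"
  shows "mmap F x x () a = a"
proof -
  have "mmap F x x () = (\<lambda>a\<in>carrier (omap F x). a)"
    using functor_id[OF assms(1), of x] assms(2) by simp
  then show ?thesis using assms(3) by simp
qed

lemma poset_functor_comp:
  assumes F: "is_functor (poset_cat Q r) Ab F" and xyz: "x \<in> Q" "y \<in> Q" "z \<in> Q" "r x y" "r y z"
    and a: "a \<in> carrier (omap F x)"
  shows "mmap F y z () (mmap F x y () a) = mmap F x z () a"
proof -
  have "mmap F x z () = compose (carrier (omap F x)) (mmap F y z ()) (mmap F x y ())"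
    using functor_comp[OF F, of x y z "()" "()"] xyz by simp
  then show ?thesis using a by (simp add: compose_def)
qed

text \<open>Functors are total records, so restricting a diagram to a subposet keeps the record
  \<open>F\<close> and only shrinks the range of the laws.\<close>

lemma poset_functor_subset:
  assumes "is_functor (poset_cat Q r) Ab F" and "U \<subseteq> Q"
  shows "is_functor (poset_cat U r) Ab F"
proof (rule poset_functorI)
  have i: "x \<in> U \<Longrightarrow> x \<in> Q" for x using assms(2) by blast
  have "is_category (poset_cat Q r)" using assms(1) by (simp add: is_functor_def)
  then show "is_category (poset_cat U r)" unfolding is_category_def by simp (blast intro: i)
  show "comm_group (omap F x)" if "x \<in> U" for x
    using functor_Ab_comm_group[OF assms(1)] that by (simp add: i)
  show "mmap F x y () \<in> hom (omap F x) (omap F y)" if "x \<in> U" "y \<in> U" "r x y" for x y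
    by (rule poset_functor_hom[OF assms(1) i i]) (fact that)+
  show "mmap F x y () \<in> extensional (carrier (omap F x))" if "x \<in> U" "y \<in> U" "r x y" for x y
    by (rule poset_functor_extensional[OF assms(1) i i]) (fact that)+
  show "mmap F x x () a = a" if "x \<in> U" "a \<in> carrier (omap F x)" for x a
    by (rule poset_functor_id[OF assms(1) i]) (fact that)+
  show "mmap F y z () (mmap F x y () a) = mmap F x z () a"
    if "x \<in> U" "y \<in> U" "z \<in> U" "r x y" "r y z" "a \<in> carrier (omap F x)" for x y z a
    by (rule poset_functor_comp[OF assms(1) i i i]) (fact that)+
qed

lemma poset_coconeI:
  assumes "comm_group A" and "\<And>x. x \<in> Q \<Longrightarrow> \<phi> x \<in> hom (omap F x) A"
    and "\<And>x y a. \<lbrakk>x \<in> Q; y \<in> Q; r x y; a \<in> carrier (omap F x)\<rbrakk>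
           \<Longrightarrow> \<phi> y (mmap F x y () a) = \<phi> x a"
  shows "cocone (poset_cat Q r) F A \<phi>"
  using assms by (intro coconeI) auto

lemma poset_cocone_commute:
  "\<lbrakk>cocone (poset_cat Q r) F A \<phi>; x \<in> Q; y \<in> Q; r x y; a \<in> carrier (omap F x)\<rbrakk>
   \<Longrightarrow> \<phi> y (mmap F x y () a) = \<phi> x a"
  using cocone_commute[of "poset_cat Q r" F A \<phi> x y "()" a] by simp

lemma poset_cocone_hom:
  "\<lbrakk>cocone (poset_cat Q r) F A \<phi>; x \<in> Q\<rbrakk> \<Longrightarrow> \<phi> x \<in> hom (omap F x) A"
  by (simp add: cocone_hom)

lemma poset_cocone_subset:
  "cocone (poset_cat Q r) F A \<phi> \<Longrightarrow> U \<subseteq> Q \<Longrightarrow> cocone (poset_cat U r) F A \<phi>"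
  unfolding cocone_def by (simp add: subset_iff)

lemma natural_posetI:
  assumes "\<eta> \<in> extensional Q"
    and "\<And>x. x \<in> Q \<Longrightarrow> \<eta> x \<in> hom (omap F x) (omap G x)"
    and "\<And>x. x \<in> Q \<Longrightarrow> \<eta> x \<in> extensional (carrier (omap F x))"
    and "\<And>x y a. \<lbrakk>x \<in> Q; y \<in> Q; r x y; a \<in> carrier (omap F x)\<rbrakk>
           \<Longrightarrow> \<eta> y (mmap F x y () a) = mmap G x y () (\<eta> x a)"
  shows "is_natural (poset_cat Q r) Ab F G \<eta>"
  unfolding is_natural_def
proof (intro conjI ballI)
  show "\<eta> \<in> (\<Pi>\<^sub>E x\<in>Obj (poset_cat Q r). Hom Ab (omap F x) (omap G x))"
    using assms(1-3) by (simp add: PiE_iff)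
  fix x y m
  assume "x \<in> Obj (poset_cat Q r)" "y \<in> Obj (poset_cat Q r)" "m \<in> Hom (poset_cat Q r) x y"
  then show "Comp Ab (omap F x) (omap F y) (omap G y) (\<eta> y) (mmap F x y m) =
      Comp Ab (omap F x) (omap G x) (omap G y) (mmap G x y m) (\<eta> x)"
    using assms(4)[of x y] by (simp add: compose_def cong: restrict_cong)
qed

lemma natural_poset_hom:
  "is_natural (poset_cat Q r) Ab F G \<eta> \<Longrightarrow> x \<in> Q \<Longrightarrow> \<eta> x \<in> hom (omap F x) (omap G x)"
  using natural_component[of "poset_cat Q r" Ab F G \<eta> x] by simp

lemma natural_poset_square:
  assumes "is_natural (poset_cat Q r) Ab F G \<eta>" and "x \<in> Q" "y \<in> Q" "r x y"
    and "a \<in> carrier (omap F x)"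
  shows "\<eta> y (mmap F x y () a) = mmap G x y () (\<eta> x a)"
proof -
  have "compose (carrier (omap F x)) (\<eta> y) (mmap F x y ())
      = compose (carrier (omap F x)) (mmap G x y ()) (\<eta> x)"
    using natural_square[OF assms(1), of x y "()"] assms(2-4) by simp
  from fun_cong[OF this, of a] show ?thesis using assms(5) by (simp add: compose_def)
qed

section \<open>Precosheaves on a topological space\<close>

lemma category_open_cat: "is_category (open_cat X)"
  unfolding open_cat_def by (rule category_poset_cat) (auto simp: reflp_on_def transp_on_def)

lemma precosheaf_hom:
  "\<lbrakk>is_functor (open_cat X) Ab G; openin X U; openin X V; U \<subseteq> V\<rbrakk>
   \<Longrightarrow> mmap G U V () \<in> hom (omap G U) (omap G V)"
  unfolding open_cat_def by (rule poset_functor_hom[of "{U. openin X U}" "(\<subseteq>)"]) auto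

lemma precosheaf_closed:
  "\<lbrakk>is_functor (open_cat X) Ab G; openin X U; openin X V; U \<subseteq> V; a \<in> carrier (omap G U)\<rbrakk>
   \<Longrightarrow> mmap G U V () a \<in> carrier (omap G V)"
  unfolding open_cat_def by (rule poset_functor_closed[of "{U. openin X U}" "(\<subseteq>)"]) auto

lemma precosheaf_id:
  "\<lbrakk>is_functor (open_cat X) Ab G; openin X U; a \<in> carrier (omap G U)\<rbrakk> \<Longrightarrow> mmap G U U () a = a"
  unfolding open_cat_def by (rule poset_functor_id[of "{U. openin X U}" "(\<subseteq>)"]) auto

lemma precosheaf_comp:
  "\<lbrakk>is_functor (open_cat X) Ab G; openin X U; openin X V; openin X W; U \<subseteq> V; V \<subseteq> W;
    a \<in> carrier (omap G U)\<rbrakk>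
   \<Longrightarrow> mmap G V W () (mmap G U V () a) = mmap G U W () a"
  unfolding open_cat_def by (rule poset_functor_comp[of "{U. openin X U}" "(\<subseteq>)"]) auto

lemma precosheaf_comm_group:
  "is_functor (open_cat X) Ab G \<Longrightarrow> openin X U \<Longrightarrow> comm_group (omap G U)"
  using functor_Ab_comm_group[of "open_cat X" G U] by (simp add: open_cat_def)

section \<open>Nerve diagrams and the natural map out of their colimit\<close>

abbreviation nerve_sets :: "'a set set \<Rightarrow> 'a set set set" where
  "nerve_sets \<U> \<equiv> {S. S \<subseteq> \<U> \<and> finite S \<and> S \<noteq> {} \<and> \<Inter>S \<noteq> {}}"

text \<open>Finiteness and non-emptiness of the members of the nerve are what keeps their
  intersections open.\<close>

lemma openin_nerve_Inter:
  "\<lbrakk>\<forall>V\<in>\<U>. openin X V; S \<in> nerve_sets \<U>\<rbrakk> \<Longrightarrow> openin X (\<Inter>S)"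
  by (intro openin_Inter) auto

text \<open>Arrows of the nerve drop members of a family, which enlarges the intersection; hence the
  reverse inclusion in \<open>nerve\<close>.\<close>

lemma nerve_Inter_mono: "S \<in> nerve_sets \<U> \<Longrightarrow> T \<subseteq> S \<Longrightarrow> \<Inter>S \<subseteq> \<Inter>T"
  by blast

lemma functor_nerve_diagram:
  assumes G: "is_functor (open_cat X) Ab G" and \<U>: "\<forall>V\<in>\<U>. openin X V"
  shows "is_functor (nerve \<U>) Ab (nerve_diagram G)"
  unfolding nerve_def
proof (rule poset_functorI)
  show "is_category (poset_cat (nerve_sets \<U>) (\<supseteq>))"
    by (rule category_poset_cat) (auto simp: reflp_on_def transp_on_def)
next
  fix S assume S: "S \<in> nerve_sets \<U>"
  show "comm_group (omap (nerve_diagram G) S)"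
    using precosheaf_comm_group[OF G openin_nerve_Inter[OF \<U> S]] by (simp add: nerve_diagram_def)
next
  fix S T assume S: "S \<in> nerve_sets \<U>" and T: "T \<in> nerve_sets \<U>" and ST: "T \<subseteq> S"
  show "mmap (nerve_diagram G) S T () \<in> hom (omap (nerve_diagram G) S) (omap (nerve_diagram G) T)"
    using precosheaf_hom[OF G openin_nerve_Inter[OF \<U> S] openin_nerve_Inter[OF \<U> T]]
      nerve_Inter_mono[OF S ST] by (simp add: nerve_diagram_def)
  show "mmap (nerve_diagram G) S T () \<in> extensional (carrier (omap (nerve_diagram G) S))"
    using poset_functor_extensional[OF G[unfolded open_cat_def], of "\<Inter>S" "\<Inter>T"]
      openin_nerve_Inter[OF \<U> S] openin_nerve_Inter[OF \<U> T] nerve_Inter_mono[OF S ST]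
    by (simp add: nerve_diagram_def)
next
  fix S a assume S: "S \<in> nerve_sets \<U>" and "a \<in> carrier (omap (nerve_diagram G) S)"
  then show "mmap (nerve_diagram G) S S () a = a"
    using precosheaf_id[OF G openin_nerve_Inter[OF \<U> S]] by (simp add: nerve_diagram_def)
next
  fix S T R a
  assume S: "S \<in> nerve_sets \<U>" and T: "T \<in> nerve_sets \<U>" and R: "R \<in> nerve_sets \<U>"
    and ST: "T \<subseteq> S" and TR: "R \<subseteq> T" and "a \<in> carrier (omap (nerve_diagram G) S)"
  then show "mmap (nerve_diagram G) T R () (mmap (nerve_diagram G) S T () a)
      = mmap (nerve_diagram G) S R () a"
    using precosheaf_comp[OF G openin_nerve_Inter[OF \<U> S] openin_nerve_Inter[OF \<U> T]
        openin_nerve_Inter[OF \<U> R] nerve_Inter_mono[OF S ST] nerve_Inter_mono[OF T TR]]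
    by (simp add: nerve_diagram_def)
qed

text \<open>The extension maps into \<open>G U\<close> form a cocone by functoriality of
  \<open>G\<close>. With these two facts the later proofs see \<open>nerve_map\<close> only through
  its values on coprojections.\<close>

lemma
  assumes G: "is_functor (open_cat X) Ab G" and U: "openin X U"
    and \<U>: "\<forall>V\<in>\<U>. openin X V" "\<Union>\<U> = U"
  shows nerve_map_hom:
      "nerve_map G \<U> U \<in> hom (colim_group (nerve \<U>) (nerve_diagram G)) (omap G U)"
    and nerve_map_apply:
      "\<And>S a. \<lbrakk>S \<in> nerve_sets \<U>; a \<in> carrier (omap G (\<Inter>S))\<rbrakk> \<Longrightarrow>
         nerve_map G \<U> U (colim_in (nerve \<U>) (nerve_diagram G) S a) = mmap G (\<Inter>S) U () a"
proof -
  have sub: "\<Inter>S \<subseteq> U" if "S \<in> nerve_sets \<U>" for S using that \<U>(2) by blast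
  have c: "cocone (nerve \<U>) (nerve_diagram G) (omap G U) (\<lambda>S. mmap G (\<Inter>S) U ())"
    unfolding nerve_def
  proof (rule poset_coconeI)
    show "comm_group (omap G U)" by (rule precosheaf_comm_group[OF G U])
  next
    fix S assume S: "S \<in> nerve_sets \<U>"
    show "mmap G (\<Inter>S) U () \<in> hom (omap (nerve_diagram G) S) (omap G U)"
      using precosheaf_hom[OF G openin_nerve_Inter[OF \<U>(1) S] U sub[OF S]]
      by (simp add: nerve_diagram_def)
  next
    fix S T a
    assume S: "S \<in> nerve_sets \<U>" and T: "T \<in> nerve_sets \<U>" and ST: "T \<subseteq> S"
      and a: "a \<in> carrier (omap (nerve_diagram G) S)"
    show "mmap G (\<Inter>T) U () (mmap (nerve_diagram G) S T () a) = mmap G (\<Inter>S) U () a"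
      using precosheaf_comp[OF G openin_nerve_Inter[OF \<U>(1) S] openin_nerve_Inter[OF \<U>(1) T] U
          nerve_Inter_mono[OF S ST] sub[OF T]] a by (simp add: nerve_diagram_def)
  qed
  note L = colim_group_is_colimit[OF functor_nerve_diagram[OF G \<U>(1)]]
  show "nerve_map G \<U> U \<in> hom (colim_group (nerve \<U>) (nerve_diagram G)) (omap G U)"
    unfolding nerve_map_def by (rule induced_map_hom[OF L c])
  show "nerve_map G \<U> U (colim_in (nerve \<U>) (nerve_diagram G) S a) = mmap G (\<Inter>S) U () a"
    if "S \<in> nerve_sets \<U>" "a \<in> carrier (omap G (\<Inter>S))" for S a
    unfolding nerve_map_def using that
    by (intro induced_map_apply[OF L c]) (simp_all add: nerve_def nerve_diagram_def)
qed

section \<open>Cellular cosheaves give cosheaves\<close>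

text \<open>The parameter \<open>u\<close> carries no data; it fixes the universe type
  \<open>'u\<close> to which the size assumptions refer.\<close>

locale small_poset =
  fixes P :: "'a set" and leq :: "'a \<Rightarrow> 'a \<Rightarrow> bool" and u :: "'u itself"
  assumes reflp: "reflp_on P leq" and transp: "transp_on P leq"
    and infinite_universe: "infinite (UNIV :: 'u set)" and small: "P \<lesssim> (UNIV :: 'u set)"
begin

abbreviation X :: "'a topology" where "X \<equiv> alexandroff P leq"
abbreviation sub_cat :: "'a set \<Rightarrow> ('a, unit) category" where "sub_cat U \<equiv> poset_cat U leq"

definition down :: "'a \<Rightarrow> 'a set" where "down x = {y \<in> P. leq y x}"

lemma openin_X: "openin X U \<longleftrightarrow> U \<subseteq> P \<and> (\<forall>x\<in>U. \<forall>y\<in>P. leq y x \<longrightarrow> y \<in> U)"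
  using reflp transp by (rule openin_alexandroff)

lemma openin_subset_P: "openin X U \<Longrightarrow> U \<subseteq> P"
  by (simp add: openin_X)

lemma openin_memD: "openin X U \<Longrightarrow> x \<in> U \<Longrightarrow> x \<in> P"
  using openin_subset_P by blast

lemma openin_down: "x \<in> P \<Longrightarrow> openin X (down x)"
  using transp unfolding openin_X down_def transp_on_def by blast

lemma down_subset: "openin X U \<Longrightarrow> x \<in> U \<Longrightarrow> down x \<subseteq> U"
  unfolding openin_X down_def by blast

lemma down_self: "x \<in> P \<Longrightarrow> x \<in> down x"
  using reflp by (simp add: down_def reflp_on_def)

lemma down_subset_P: "down x \<subseteq> P"
  by (auto simp: down_def)

lemma down_mono: "\<lbrakk>x \<in> P; y \<in> P; leq x y\<rbrakk> \<Longrightarrow> down x \<subseteq> down y"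
  by (rule down_subset[OF openin_down]) (simp_all add: down_def)

lemma category_P: "is_category (sub_cat P)"
  using reflp transp by (rule category_poset_cat)

section \<open>The precosheaf of colimits over open sets\<close>

lemma hat_obj_omap [simp]: "omap (hat_obj leq F) U = Ab_colim (sub_cat U) F"
  by (simp add: hat_obj_def)

text \<open>A subset of \<open>P\<close> injects into the universe because \<open>P\<close> does, so
  its colimit can be formed inside \<open>'u\<close>.\<close>

lemma hat_obj_colimit:
  fixes F :: "('a, unit, 'u monoid, 'u \<Rightarrow> 'u) cfunctor"
  assumes "is_functor (sub_cat P) Ab F" and "U \<subseteq> P"
  shows "is_colimit TYPE('b) (sub_cat U) F (Ab_colim (sub_cat U) F) (Ab_colim_in (sub_cat U) F)"
proof -
  have "U \<lesssim> (UNIV :: 'u set)"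
    using subset_imp_lepoll[OF assms(2)] small by (rule lepoll_trans)
  then show ?thesis
    using poset_functor_subset[OF assms] infinite_universe by (intro Ab_colim_is_colimit) simp_all
qed

context
  fixes F :: "('a, unit, 'u monoid, 'u \<Rightarrow> 'u) cfunctor"
  assumes F: "is_functor (sub_cat P) Ab F"
begin

lemma hat_obj_comm_group: "U \<subseteq> P \<Longrightarrow> comm_group (Ab_colim (sub_cat U) F)"
  using cocone_comm_group[OF colimit_cocone[OF hat_obj_colimit[OF F]]] .

lemma hat_obj_cocone:
  "U \<subseteq> P \<Longrightarrow> cocone (sub_cat U) F (Ab_colim (sub_cat U) F) (Ab_colim_in (sub_cat U) F)"
  by (rule colimit_cocone[OF hat_obj_colimit[OF F]])

lemma hat_obj_in_hom:
  "U \<subseteq> P \<Longrightarrow> x \<in> U \<Longrightarrow> Ab_colim_in (sub_cat U) F x \<in> hom (omap F x) (Ab_colim (sub_cat U) F)"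
  by (rule poset_cocone_hom[OF hat_obj_cocone])

lemma hat_obj_in_closed:
  "\<lbrakk>U \<subseteq> P; x \<in> U; a \<in> carrier (omap F x)\<rbrakk>
   \<Longrightarrow> Ab_colim_in (sub_cat U) F x a \<in> carrier (Ab_colim (sub_cat U) F)"
  by (rule hom_in_carrier[OF hat_obj_in_hom])

lemma hat_obj_in_commute:
  "\<lbrakk>U \<subseteq> P; x \<in> U; y \<in> U; leq x y; a \<in> carrier (omap F x)\<rbrakk>
   \<Longrightarrow> Ab_colim_in (sub_cat U) F y (mmap F x y () a) = Ab_colim_in (sub_cat U) F x a"
  by (rule poset_cocone_commute[OF hat_obj_cocone])

lemma hat_obj_eqI:
  fixes A :: "'b monoid"
  assumes "U \<subseteq> P" and "comm_group A"
    and "h \<in> hom (Ab_colim (sub_cat U) F) A" and "k \<in> hom (Ab_colim (sub_cat U) F) A"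
    and "\<And>x a. \<lbrakk>x \<in> U; a \<in> carrier (omap F x)\<rbrakk> \<Longrightarrow>
           h (Ab_colim_in (sub_cat U) F x a) = k (Ab_colim_in (sub_cat U) F x a)"
    and "z \<in> carrier (Ab_colim (sub_cat U) F)"
  shows "h z = k z"
  by (rule colimit_hom_eqI[OF hat_obj_colimit[OF F assms(1)] assms(2-4) _ assms(6)])
     (simp add: assms(5))

text \<open>The coprojections for \<open>V\<close>, restricted to indices in \<open>U\<close>, are a
  cocone on the smaller diagram, and the extension map is what they induce.\<close>

lemma
  assumes "U \<subseteq> V" and "V \<subseteq> P"
  shows hat_obj_map_hom:
      "mmap (hat_obj leq F) U V () \<in> hom (Ab_colim (sub_cat U) F) (Ab_colim (sub_cat V) F)"
    and hat_obj_map_extensional: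
      "mmap (hat_obj leq F) U V () \<in> extensional (carrier (Ab_colim (sub_cat U) F))"
    and hat_obj_map_apply: "\<And>x a. \<lbrakk>x \<in> U; a \<in> carrier (omap F x)\<rbrakk> \<Longrightarrow>
      mmap (hat_obj leq F) U V () (Ab_colim_in (sub_cat U) F x a) = Ab_colim_in (sub_cat V) F x a"
proof -
  have U: "U \<subseteq> P" using assms by blast
  note c = poset_cocone_subset[OF hat_obj_cocone[OF assms(2)] assms(1)]
  show "mmap (hat_obj leq F) U V () \<in> hom (Ab_colim (sub_cat U) F) (Ab_colim (sub_cat V) F)"
    "mmap (hat_obj leq F) U V () \<in> extensional (carrier (Ab_colim (sub_cat U) F))"
    using induced_map_hom[OF hat_obj_colimit[OF F U] c]
      induced_map_extensional[OF hat_obj_colimit[OF F U] c] by (simp_all add: hat_obj_def)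
  show "mmap (hat_obj leq F) U V () (Ab_colim_in (sub_cat U) F x a) = Ab_colim_in (sub_cat V) F x a"
    if "x \<in> U" "a \<in> carrier (omap F x)" for x a
    using induced_map_apply[OF hat_obj_colimit[OF F U] c, of x a] that by (simp add: hat_obj_def)
qed

lemma hat_obj_functor: "is_functor (open_cat X) Ab (hat_obj leq F)"
  unfolding open_cat_def
proof (rule poset_functorI)
  show "is_category (poset_cat {U. openin X U} (\<subseteq>))"
    using category_open_cat[of X] by (simp add: open_cat_def)
next
  fix U assume "U \<in> {U. openin X U}"
  then have U: "U \<subseteq> P" using openin_subset_P by simp
  show "comm_group (omap (hat_obj leq F) U)" using hat_obj_comm_group[OF U] by simp
  fix z assume z: "z \<in> carrier (omap (hat_obj leq F) U)"
  have i: "(\<lambda>z. z) \<in> hom (Ab_colim (sub_cat U) F) (Ab_colim (sub_cat U) F)" by (simp add: hom_def)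
  show "mmap (hat_obj leq F) U U () z = z"
    by (rule hat_obj_eqI[OF U hat_obj_comm_group[OF U] hat_obj_map_hom[OF subset_refl U] i])
       (use z hat_obj_map_apply[OF subset_refl U] in simp_all)
next
  fix U V assume h: "U \<in> {U. openin X U}" "V \<in> {U. openin X U}" "U \<subseteq> V"
  then have V: "V \<subseteq> P" using openin_subset_P by simp
  show "mmap (hat_obj leq F) U V () \<in> hom (omap (hat_obj leq F) U) (omap (hat_obj leq F) V)"
    "mmap (hat_obj leq F) U V () \<in> extensional (carrier (omap (hat_obj leq F) U))"
    using hat_obj_map_hom[OF h(3) V] hat_obj_map_extensional[OF h(3) V] by simp_all
next
  fix U V W z
  assume h: "U \<in> {U. openin X U}" "V \<in> {U. openin X U}" "W \<in> {U. openin X U}" "U \<subseteq> V" "V \<subseteq> W"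
    and z: "z \<in> carrier (omap (hat_obj leq F) U)"
  then have W: "W \<subseteq> P" using openin_subset_P by simp
  have V: "V \<subseteq> P" and U: "U \<subseteq> P" and UW: "U \<subseteq> W" using h(4,5) W by auto
  show "mmap (hat_obj leq F) V W () (mmap (hat_obj leq F) U V () z) = mmap (hat_obj leq F) U W () z"
  proof (rule hat_obj_eqI[OF U hat_obj_comm_group[OF W] _ hat_obj_map_hom[OF UW W]])
    show "(\<lambda>z. mmap (hat_obj leq F) V W () (mmap (hat_obj leq F) U V () z))
        \<in> hom (Ab_colim (sub_cat U) F) (Ab_colim (sub_cat W) F)"
      using hom_compose[OF hat_obj_map_hom[OF h(4) V] hat_obj_map_hom[OF h(5) W]] by (simp add: o_def)
    fix x a assume x: "x \<in> U" and a: "a \<in> carrier (omap F x)"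
    have "x \<in> V" using x h(4) by blast
    then show "mmap (hat_obj leq F) V W () (mmap (hat_obj leq F) U V () (Ab_colim_in (sub_cat U) F x a))
        = mmap (hat_obj leq F) U W () (Ab_colim_in (sub_cat U) F x a)"
      using hat_obj_map_apply[OF h(4) V x a] hat_obj_map_apply[OF UW W x a]
        hat_obj_map_apply[OF h(5) W _ a] by simp
  qed (use z in simp)
qed

text \<open>
  The inverse of the nerve map sends the summand \<open>F x\<close> to the value on any member of the cover
  containing \<open>x\<close>; two such members \<open>V\<close>, \<open>W\<close> give the same result because of \<open>{V, W}\<close> in the nerve.
\<close>

lemma hat_obj_nerve_map_iso:
  assumes U: "openin X U" and \<U>: "\<forall>V\<in>\<U>. openin X V" "\<Union>\<U> = U"
  shows "nerve_map (hat_obj leq F) \<U> U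
    \<in> iso (colim_group (nerve \<U>) (nerve_diagram (hat_obj leq F))) (omap (hat_obj leq F) U)"
proof -
  define D where "D = nerve_diagram (hat_obj leq F)"
  define L where "L = colim_group (nerve \<U>) D"
  define \<iota> where "\<iota> = colim_in (nerve \<U>) D"
  define n where "n = nerve_map (hat_obj leq F) \<U> U"
  let ?in = "\<lambda>V. Ab_colim_in (sub_cat V) F"
  have DS: "omap D S = Ab_colim (sub_cat (\<Inter>S)) F" for S by (simp add: D_def nerve_diagram_def)
  have UP: "U \<subseteq> P" using U by (rule openin_subset_P)
  have SU: "\<Inter>S \<subseteq> U" if "S \<in> nerve_sets \<U>" for S using that \<U>(2) by blast
  have SP: "\<Inter>S \<subseteq> P" if "S \<in> nerve_sets \<U>" for S using SU[OF that] UP by blast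
  have fD: "is_functor (nerve \<U>) Ab D"
    unfolding D_def by (rule functor_nerve_diagram[OF hat_obj_functor \<U>(1)])
  \<comment> \<open>\<open>L\<close> is also the target of the maps compared below, so the test type
    is that of its own cosets.\<close>
  have LC: "is_colimit TYPE(('a set set \<Rightarrow> 'u) set) (nerve \<U>) D L \<iota>"
    unfolding L_def \<iota>_def by (rule colim_group_is_colimit[OF fD])
  note \<iota>c = colimit_cocone[OF LC]
  note cL = cocone_comm_group[OF \<iota>c]
  have \<iota>h: "\<iota> S \<in> hom (Ab_colim (sub_cat (\<Inter>S)) F) L" if "S \<in> nerve_sets \<U>" for S
    using poset_cocone_hom[OF \<iota>c[unfolded nerve_def] that] by (simp add: DS)
  have n: "n \<in> hom L (Ab_colim (sub_cat U) F)"
    using nerve_map_hom[OF hat_obj_functor U \<U>] by (simp add: n_def L_def D_def)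
  have n_app: "n (\<iota> S (?in (\<Inter>S) x a)) = ?in U x a"
    if "S \<in> nerve_sets \<U>" "x \<in> \<Inter>S" "a \<in> carrier (omap F x)" for S x a
    using nerve_map_apply[OF hat_obj_functor U \<U> that(1)] hat_obj_map_apply[OF SU[OF that(1)] UP that(2,3)]
      hat_obj_in_closed[OF SP[OF that(1)] that(2,3)] by (simp add: n_def \<iota>_def D_def)
  \<comment> \<open>The point \<open>x\<close> matters: the nerve keeps only families with nonempty
    intersection, so an empty member of the cover gives no vertex.\<close>
  have single: "{V} \<in> nerve_sets \<U>" if "V \<in> \<U>" "x \<in> V" for V x using that by auto
  have to_single: "\<iota> S (?in (\<Inter>S) x a) = \<iota> {V} (?in V x a)"
    if S: "S \<in> nerve_sets \<U>" and x: "x \<in> \<Inter>S" and a: "a \<in> carrier (omap F x)" and V: "V \<in> S"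
    for S x a V
  proof -
    have xV: "x \<in> V" "V \<in> \<U>" "\<Inter>S \<subseteq> V" using x V S by auto
    have VP: "V \<subseteq> P" using \<U>(1) xV(2) openin_subset_P by blast
    have "\<iota> {V} (mmap D S {V} () (?in (\<Inter>S) x a)) = \<iota> S (?in (\<Inter>S) x a)"
      by (rule poset_cocone_commute[OF \<iota>c[unfolded nerve_def] S single[OF xV(2,1)]])
         (use V hat_obj_in_closed[OF SP[OF S] x a] in \<open>auto simp: DS\<close>)
    then show ?thesis
      using hat_obj_map_apply[OF xV(3) VP x a] by (simp add: D_def nerve_diagram_def)
  qed
  have indep: "\<iota> {V} (?in V x a) = \<iota> {W} (?in W x a)"
    if "V \<in> \<U>" "W \<in> \<U>" "x \<in> V" "x \<in> W" "a \<in> carrier (omap F x)" for V W x a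
  proof -
    have "{V, W} \<in> nerve_sets \<U>" "x \<in> \<Inter>{V, W}" using that by auto
    then show ?thesis using to_single[of "{V, W}" x a V] to_single[of "{V, W}" x a W] that(5) by simp
  qed
  have "\<forall>x\<in>U. \<exists>V. V \<in> \<U> \<and> x \<in> V" using \<U>(2) by blast
  then obtain v where v: "\<And>x. x \<in> U \<Longrightarrow> v x \<in> \<U> \<and> x \<in> v x" by metis
  have vo: "openin X (v x)" if "x \<in> U" for x using v[OF that] \<U>(1) by blast
  have vP: "v x \<subseteq> P" if "x \<in> U" for x using openin_subset_P[OF vo[OF that]] .
  define \<psi> where "\<psi> = (\<lambda>x a. \<iota> {v x} (?in (v x) x a))"
  have \<psi>: "cocone (sub_cat U) F L \<psi>"
  proof (rule poset_coconeI[OF cL])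
    fix x assume x: "x \<in> U"
    then have "{v x} \<in> nerve_sets \<U>" using v single by blast
    from hom_compose[OF hat_obj_in_hom[OF vP[OF x]] \<iota>h[OF this, simplified]] v[OF x]
    show "\<psi> x \<in> hom (omap F x) L" by (simp add: \<psi>_def o_def)
  next
    fix x y a assume h: "x \<in> U" "y \<in> U" "leq x y" "a \<in> carrier (omap F x)"
    \<comment> \<open>Open sets are lower sets, so the member chosen for \<open>y\<close> contains
      \<open>x\<close> as well and can be compared with the one chosen for \<open>x\<close>.\<close>
    have xy: "x \<in> v y" using vo[OF h(2)] v[OF h(2)] h(3) openin_memD[OF U h(1)] unfolding openin_X by blast
    have "\<psi> y (mmap F x y () a) = \<iota> {v y} (?in (v y) x a)"
      unfolding \<psi>_def using hat_obj_in_commute[OF vP[OF h(2)] xy _ h(3,4)] v[OF h(2)] by simp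
    also have "\<dots> = \<psi> x a" unfolding \<psi>_def using v h xy by (intro indep) auto
    finally show "\<psi> y (mmap F x y () a) = \<psi> x a" .
  qed
  define g where "g = induced_map (sub_cat U) F (Ab_colim (sub_cat U) F) (?in U) L \<psi>"
  have g: "g \<in> hom (Ab_colim (sub_cat U) F) L"
    unfolding g_def by (rule induced_map_hom[OF hat_obj_colimit[OF F UP] \<psi>])
  have g_app: "g (?in U x a) = \<psi> x a" if "x \<in> U" "a \<in> carrier (omap F x)" for x a
    unfolding g_def using that by (intro induced_map_apply[OF hat_obj_colimit[OF F UP] \<psi>]) simp_all
  have "n \<in> iso L (Ab_colim (sub_cat U) F)"
  proof (rule hom_iso_byWitness[OF n g])
    fix z assume z: "z \<in> carrier L"
    have gn: "(\<lambda>z. g (n z)) \<in> hom L L" using hom_compose[OF n g] by (simp add: o_def)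
    have i: "(\<lambda>z. z) \<in> hom L L" by (simp add: hom_def)
    show "g (n z) = z"
    \<comment> \<open>Two colimits are nested: the first comparison reduces to the coprojections
      from the groups over \<open>\<Inter>S\<close>, and as these are colimits themselves, a second
      one reduces to the groups \<open>F x\<close> with \<open>x\<close> in
      \<open>\<Inter>S\<close>.\<close>
    proof (rule colimit_hom_eqI[OF LC cL gn i _ z])
      fix S b assume "S \<in> Obj (nerve \<U>)" and b: "b \<in> carrier (omap D S)"
      then have S: "S \<in> nerve_sets \<U>" by (simp add: nerve_def)
      have gh: "(\<lambda>b. g (n (\<iota> S b))) \<in> hom (Ab_colim (sub_cat (\<Inter>S)) F) L"
        using hom_compose[OF \<iota>h[OF S] gn] by (simp add: o_def)
      show "g (n (\<iota> S b)) = \<iota> S b"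
      proof (rule hat_obj_eqI[OF SP[OF S] cL gh \<iota>h[OF S]])
        fix x a assume x: "x \<in> \<Inter>S" and a: "a \<in> carrier (omap F x)"
        obtain V where V: "V \<in> S" using S by blast
        have xU: "x \<in> U" using SU[OF S] x by blast
        have "g (n (\<iota> S (?in (\<Inter>S) x a))) = \<iota> {v x} (?in (v x) x a)"
          using n_app[OF S x a] g_app[OF xU a] by (simp add: \<psi>_def)
        also have "\<dots> = \<iota> {V} (?in V x a)"
          using v[OF xU] V S x a by (intro indep) auto
        finally show "g (n (\<iota> S (?in (\<Inter>S) x a))) = \<iota> S (?in (\<Inter>S) x a)"
          using to_single[OF S x a V] by simp
      qed (use b in \<open>simp add: DS\<close>)
    qed
  next
    fix z assume z: "z \<in> carrier (Ab_colim (sub_cat U) F)"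
    have ng: "(\<lambda>z. n (g z)) \<in> hom (Ab_colim (sub_cat U) F) (Ab_colim (sub_cat U) F)"
      using hom_compose[OF g n] by (simp add: o_def)
    have i: "(\<lambda>z. z) \<in> hom (Ab_colim (sub_cat U) F) (Ab_colim (sub_cat U) F)" by (simp add: hom_def)
    show "n (g z) = z"
    proof (rule hat_obj_eqI[OF UP hat_obj_comm_group[OF UP] ng i _ z])
      fix x a assume x: "x \<in> U" and a: "a \<in> carrier (omap F x)"
      show "n (g (?in U x a)) = ?in U x a"
        using g_app[OF x a] n_app[OF single, of "v x" x x a] v[OF x] a by (simp add: \<psi>_def)
    qed
  qed
  then show ?thesis by (simp add: n_def L_def D_def)
qed

lemma hat_obj_cosheaf: "is_cosheaf X (hat_obj leq F)"
  unfolding is_cosheaf_def using hat_obj_functor hat_obj_nerve_map_iso by blast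

text \<open>The structure maps of \<open>F\<close> into \<open>F x\<close> form a cocone on
  \<open>down x\<close> and induce the inverse. One composite is the identity law of
  \<open>F\<close>, the other the compatibility of the coprojections.\<close>

lemma hat_obj_in_down_iso:
  assumes x: "x \<in> P"
  shows "Ab_colim_in (sub_cat (down x)) F x \<in> iso (omap F x) (Ab_colim (sub_cat (down x)) F)"
proof -
  have c: "cocone (sub_cat (down x)) F (omap F x) (\<lambda>y. mmap F y x ())"
  proof (rule poset_coconeI)
    show "comm_group (omap F x)" using functor_Ab_comm_group[OF F, of x] x by simp
    show "mmap F y x () \<in> hom (omap F y) (omap F x)" if "y \<in> down x" for y
      using that x by (intro poset_functor_hom[OF F]) (auto simp: down_def)
    show "mmap F z x () (mmap F y z () a) = mmap F y x () a"
      if "y \<in> down x" "z \<in> down x" "leq y z" "a \<in> carrier (omap F y)" for y z a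
      using that x by (intro poset_functor_comp[OF F]) (auto simp: down_def)
  qed
  note C = hat_obj_colimit[OF F down_subset_P]
  let ?g = "induced_map (sub_cat (down x)) F (Ab_colim (sub_cat (down x)) F)
      (Ab_colim_in (sub_cat (down x)) F) (omap F x) (\<lambda>y. mmap F y x ())"
  have g: "?g \<in> hom (Ab_colim (sub_cat (down x)) F) (omap F x)" by (rule induced_map_hom[OF C c])
  have g_app: "?g (Ab_colim_in (sub_cat (down x)) F y a) = mmap F y x () a"
    if "y \<in> down x" "a \<in> carrier (omap F y)" for y a
    using that by (intro induced_map_apply[OF C c]) simp_all
  note i = hat_obj_in_hom[OF down_subset_P down_self[OF x]]
  show ?thesis
  proof (rule hom_iso_byWitness[OF i g])
    fix a assume a: "a \<in> carrier (omap F x)"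
    show "?g (Ab_colim_in (sub_cat (down x)) F x a) = a"
      using g_app[OF down_self[OF x] a] poset_functor_id[OF F x a] by simp
  next
    fix z assume z: "z \<in> carrier (Ab_colim (sub_cat (down x)) F)"
    have ig: "(\<lambda>z. Ab_colim_in (sub_cat (down x)) F x (?g z))
        \<in> hom (Ab_colim (sub_cat (down x)) F) (Ab_colim (sub_cat (down x)) F)"
      using hom_compose[OF g i] by (simp add: o_def)
    have id: "(\<lambda>z. z) \<in> hom (Ab_colim (sub_cat (down x)) F) (Ab_colim (sub_cat (down x)) F)"
      by (simp add: hom_def)
    show "Ab_colim_in (sub_cat (down x)) F x (?g z) = z"
    proof (rule hat_obj_eqI[OF down_subset_P hat_obj_comm_group[OF down_subset_P] ig id _ z])
      fix y a assume y: "y \<in> down x" and a: "a \<in> carrier (omap F y)"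
      show "Ab_colim_in (sub_cat (down x)) F x (?g (Ab_colim_in (sub_cat (down x)) F y a))
          = Ab_colim_in (sub_cat (down x)) F y a"
        using g_app[OF y a] hat_obj_in_commute[OF down_subset_P y down_self[OF x] _ a] y
        by (simp add: down_def)
    qed
  qed
qed

end

end

section \<open>Recovering a cosheaf from its minimal open sets\<close>

definition restrict_cosheaf :: "('a \<Rightarrow> 'a set) \<Rightarrow> ('a set, unit, 'u monoid, 'u \<Rightarrow> 'u) cfunctor \<Rightarrow>
    ('a, unit, 'u monoid, 'u \<Rightarrow> 'u) cfunctor" where
  "restrict_cosheaf d G =
     \<lparr>omap = (\<lambda>x. omap G (d x)), mmap = (\<lambda>x y m. mmap G (d x) (d y) m)\<rparr>"

lemma restrict_cosheaf_simps [simp]: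
  "omap (restrict_cosheaf d G) x = omap G (d x)"
  "mmap (restrict_cosheaf d G) x y m = mmap G (d x) (d y) m"
  by (simp_all add: restrict_cosheaf_def)

lemma cosheaf_functor: "is_cosheaf Y G \<Longrightarrow> is_functor (open_cat Y) Ab G"
  by (simp add: is_cosheaf_def)

lemma cosheaf_nerve_map_iso:
  "\<lbrakk>is_cosheaf Y G; openin Y U; \<forall>V\<in>\<U>. openin Y V; \<Union>\<U> = U\<rbrakk> \<Longrightarrow>
   nerve_map G \<U> U \<in> iso (colim_group (nerve \<U>) (nerve_diagram G)) (omap G U)"
  unfolding is_cosheaf_def by blast

context small_poset
begin

text \<open>A pullback along the monotone map from \<open>P\<close> to the open sets given by
  \<open>down\<close>.\<close>

lemma restrict_cosheaf_functor:
  assumes G: "is_functor (open_cat X) Ab G"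
  shows "is_functor (sub_cat P) Ab (restrict_cosheaf down G)"
proof (rule poset_functorI[OF category_P])
  fix x assume x: "x \<in> P"
  show "comm_group (omap (restrict_cosheaf down G) x)"
    using precosheaf_comm_group[OF G openin_down[OF x]] by simp
  show "mmap (restrict_cosheaf down G) x x () a = a"
    if "a \<in> carrier (omap (restrict_cosheaf down G) x)" for a
    using precosheaf_id[OF G openin_down[OF x]] that by simp
next
  fix x y assume x: "x \<in> P" and y: "y \<in> P" and xy: "leq x y"
  show "mmap (restrict_cosheaf down G) x y ()
      \<in> hom (omap (restrict_cosheaf down G) x) (omap (restrict_cosheaf down G) y)"
    using precosheaf_hom[OF G openin_down[OF x] openin_down[OF y] down_mono[OF x y xy]] by simp
  show "mmap (restrict_cosheaf down G) x y () \<in> extensional (carrier (omap (restrict_cosheaf down G) x))"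
    using poset_functor_extensional[OF G[unfolded open_cat_def], of "down x" "down y"]
      openin_down[OF x] openin_down[OF y] down_mono[OF x y xy] by simp
next
  fix x y z a
  assume x: "x \<in> P" and y: "y \<in> P" and z: "z \<in> P" and xy: "leq x y" and yz: "leq y z"
    and a: "a \<in> carrier (omap (restrict_cosheaf down G) x)"
  show "mmap (restrict_cosheaf down G) y z () (mmap (restrict_cosheaf down G) x y () a)
      = mmap (restrict_cosheaf down G) x z () a"
    using precosheaf_comp[OF G openin_down[OF x] openin_down[OF y] openin_down[OF z]
        down_mono[OF x y xy] down_mono[OF y z yz]] a by simp
qed

text \<open>It makes sense, and is natural in \<open>U\<close>, for every precosheaf; its
  invertibility is where the cosheaf condition comes in.\<close>

definition counit :: "('a set, unit, 'u monoid, 'u \<Rightarrow> 'u) cfunctor \<Rightarrow> 'a set \<Rightarrow> 'u \<Rightarrow> 'u" where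
  "counit G U = induced_map (sub_cat U) (restrict_cosheaf down G)
     (Ab_colim (sub_cat U) (restrict_cosheaf down G)) (Ab_colim_in (sub_cat U) (restrict_cosheaf down G))
     (omap G U) (\<lambda>x. mmap G (down x) U ())"

lemma
  assumes G: "is_functor (open_cat X) Ab G" and U: "openin X U"
  shows counit_hom: "counit G U \<in> hom (Ab_colim (sub_cat U) (restrict_cosheaf down G)) (omap G U)"
    and counit_extensional:
      "counit G U \<in> extensional (carrier (Ab_colim (sub_cat U) (restrict_cosheaf down G)))"
    and counit_apply: "\<And>x a. \<lbrakk>x \<in> U; a \<in> carrier (omap G (down x))\<rbrakk> \<Longrightarrow>
      counit G U (Ab_colim_in (sub_cat U) (restrict_cosheaf down G) x a) = mmap G (down x) U () a"
proof -
  note m = openin_memD[OF U]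
  have c: "cocone (sub_cat U) (restrict_cosheaf down G) (omap G U) (\<lambda>x. mmap G (down x) U ())"
  proof (rule poset_coconeI)
    show "comm_group (omap G U)" by (rule precosheaf_comm_group[OF G U])
    show "mmap G (down x) U () \<in> hom (omap (restrict_cosheaf down G) x) (omap G U)" if "x \<in> U" for x
      using precosheaf_hom[OF G openin_down[OF m[OF that]] U down_subset[OF U that]] by simp
    show "mmap G (down y) U () (mmap (restrict_cosheaf down G) x y () a) = mmap G (down x) U () a"
      if "x \<in> U" "y \<in> U" "leq x y" "a \<in> carrier (omap (restrict_cosheaf down G) x)" for x y a
      using precosheaf_comp[OF G openin_down[OF m[OF that(1)]] openin_down[OF m[OF that(2)]] U
          down_mono[OF m[OF that(1)] m[OF that(2)] that(3)] down_subset[OF U that(2)]] that(4)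
      by simp
  qed
  note C = hat_obj_colimit[OF restrict_cosheaf_functor[OF G] openin_subset_P[OF U]]
  show "counit G U \<in> hom (Ab_colim (sub_cat U) (restrict_cosheaf down G)) (omap G U)"
    unfolding counit_def by (rule induced_map_hom[OF C c])
  show "counit G U \<in> extensional (carrier (Ab_colim (sub_cat U) (restrict_cosheaf down G)))"
    unfolding counit_def by (rule induced_map_extensional[OF C c])
  show "counit G U (Ab_colim_in (sub_cat U) (restrict_cosheaf down G) x a) = mmap G (down x) U () a"
    if "x \<in> U" "a \<in> carrier (omap G (down x))" for x a
    unfolding counit_def using that by (intro induced_map_apply[OF C c]) simp_all
qed

section \<open>Inverting the counit of a cosheaf\<close>

lemma down_cover:
  assumes "openin X U"
  shows "\<forall>V\<in>down ` U. openin X V" and "\<Union>(down ` U) = U"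
  using openin_down[OF openin_memD[OF assms]] down_subset[OF assms] down_self[OF openin_memD[OF assms]]
  by blast+

text \<open>For a member \<open>S\<close> of the nerve of the cover by minimal open sets, the map
  from \<open>G (\<Inter>S)\<close> to \<open>G U\<close> factors through \<open>G (down x)\<close>
  for any \<open>down x\<close> in \<open>S\<close>. So the groups on minimal open sets already
  generate \<open>G U\<close>. In \<open>counit_iso\<close> this is applied to intersections in a
  nerve.\<close>

lemma cosheaf_hom_eqI:
  fixes A :: "'b monoid"
  assumes G: "is_cosheaf X G" and U: "openin X U" and A: "comm_group A"
    and h: "h \<in> hom (omap G U) A" and k: "k \<in> hom (omap G U) A"
    and eq: "\<And>x a. \<lbrakk>x \<in> U; a \<in> carrier (omap G (down x))\<rbrakk> \<Longrightarrow>
               h (mmap G (down x) U () a) = k (mmap G (down x) U () a)"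
    and b: "b \<in> carrier (omap G U)"
  shows "h b = k b"
proof -
  define \<U> where "\<U> = down ` U"
  note fG = cosheaf_functor[OF G]
  note \<U> = down_cover[OF U, folded \<U>_def]
  note C = colim_group_is_colimit[OF functor_nerve_diagram[OF fG \<U>(1)]]
  define n where "n = nerve_map G \<U> U"
  have n: "n \<in> iso (colim_group (nerve \<U>) (nerve_diagram G)) (omap G U)"
    unfolding n_def by (rule cosheaf_nerve_map_iso[OF G U \<U>])
  then have nh: "n \<in> hom (colim_group (nerve \<U>) (nerve_diagram G)) (omap G U)"
    by (simp add: iso_def)
  \<comment> \<open>Surjectivity of the nerve map lifts \<open>b\<close> to the nerve colimit, where
    maps are compared on coprojections.\<close>
  obtain c where c: "c \<in> carrier (colim_group (nerve \<U>) (nerve_diagram G))" "b = n c"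
    using n b unfolding iso_iff by blast
  have "h (n c) = k (n c)"
  proof (rule colimit_hom_eqI[OF C A _ _ _ c(1)])
    show "(\<lambda>c. h (n c)) \<in> hom (colim_group (nerve \<U>) (nerve_diagram G)) A"
      "(\<lambda>c. k (n c)) \<in> hom (colim_group (nerve \<U>) (nerve_diagram G)) A"
      using hom_compose[OF nh h] hom_compose[OF nh k] by (simp_all add: o_def)
  next
    fix S a assume "S \<in> Obj (nerve \<U>)" and a': "a \<in> carrier (omap (nerve_diagram G) S)"
    then have S: "S \<in> nerve_sets \<U>" by (simp add: nerve_def)
    have a: "a \<in> carrier (omap G (\<Inter>S))" using a' by (simp add: nerve_diagram_def)
    obtain x where x: "x \<in> U" "down x \<in> S" using S unfolding \<U>_def by blast
    have sub: "\<Inter>S \<subseteq> down x" using x by blast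
    note od = openin_down[OF openin_memD[OF U x(1)]]
    have "n (colim_in (nerve \<U>) (nerve_diagram G) S a) = mmap G (\<Inter>S) U () a"
      unfolding n_def by (rule nerve_map_apply[OF fG U \<U> S a])
    also have "\<dots> = mmap G (down x) U () (mmap G (\<Inter>S) (down x) () a)"
      using precosheaf_comp[OF fG openin_nerve_Inter[OF \<U>(1) S] od U sub down_subset[OF U x(1)] a]
      by simp
    finally show "h (n (colim_in (nerve \<U>) (nerve_diagram G) S a))
        = k (n (colim_in (nerve \<U>) (nerve_diagram G) S a))"
      using eq[OF x(1) precosheaf_closed[OF fG openin_nerve_Inter[OF \<U>(1) S] od sub a]] by simp
  qed
  then show ?thesis using c(2) by simp
qed

text \<open>
  The inverse of the counit comes from the cover of \<open>U\<close> by minimal open sets: an intersection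
  \<open>\<Inter>S\<close> of members of the cover is mapped to the value on any \<open>down x \<in> S\<close>.  That the choice of
  \<open>x\<close> does not matter is checked on the minimal open sets inside \<open>\<Inter>S\<close>, where it is the cocone
  condition.
\<close>

lemma counit_iso:
  assumes G: "is_cosheaf X G" and U: "openin X U"
  shows "counit G U \<in> iso (Ab_colim (sub_cat U) (restrict_cosheaf down G)) (omap G U)"
proof -
  define R where "R = restrict_cosheaf down G"
  define K where "K = Ab_colim (sub_cat U) R"
  define \<kappa> where "\<kappa> = Ab_colim_in (sub_cat U) R"
  define \<U> where "\<U> = down ` U"
  define D where "D = nerve_diagram G"
  define L where "L = colim_group (nerve \<U>) D"
  define \<iota> where "\<iota> = colim_in (nerve \<U>) D"
  define n where "n = nerve_map G \<U> U"
  note fG = cosheaf_functor[OF G]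
  note \<U> = down_cover[OF U, folded \<U>_def]
  have fR: "is_functor (sub_cat P) Ab R" unfolding R_def by (rule restrict_cosheaf_functor[OF fG])
  have R[simp]: "omap R x = omap G (down x)" "mmap R x y m = mmap G (down x) (down y) m" for x y m
    by (simp_all add: R_def)
  have DS: "omap D S = omap G (\<Inter>S)" for S by (simp add: D_def nerve_diagram_def)
  note UP = openin_subset_P[OF U]
  note mP = openin_memD[OF U]
  note od = openin_down[OF mP]
  note cK = hat_obj_comm_group[OF fR UP, folded K_def]
  note oS = openin_nerve_Inter[OF \<U>(1)]
  note \<kappa>h = hat_obj_in_hom[OF fR UP, folded K_def \<kappa>_def]
  have e: "counit G U \<in> hom K (omap G U)"
    using counit_hom[OF fG U] by (simp add: K_def R_def)
  have e_app: "counit G U (\<kappa> x a) = mmap G (down x) U () a"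
    if "x \<in> U" "a \<in> carrier (omap G (down x))" for x a
    using counit_apply[OF fG U that] by (simp add: \<kappa>_def R_def)
  \<comment> \<open>Here the targets are \<open>K\<close> and \<open>G U\<close>, both inside the
    universe.\<close>
  have L: "is_colimit TYPE('u) (nerve \<U>) D L \<iota>"
    unfolding L_def \<iota>_def D_def
    by (rule colim_group_is_colimit[OF functor_nerve_diagram[OF fG \<U>(1)]])
  note \<iota>c = colimit_cocone[OF L]
  have n: "n \<in> iso L (omap G U)"
    unfolding n_def L_def D_def by (rule cosheaf_nerve_map_iso[OF G U \<U>])
  have n_app: "n (\<iota> S a) = mmap G (\<Inter>S) U () a"
    if "S \<in> nerve_sets \<U>" "a \<in> carrier (omap G (\<Inter>S))" for S a
    unfolding n_def \<iota>_def D_def by (rule nerve_map_apply[OF fG U \<U> that])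
  have indep: "\<kappa> x (mmap G (\<Inter>S) (down x) () b) = \<kappa> y (mmap G (\<Inter>S) (down y) () b)"
    if S: "S \<in> nerve_sets \<U>" and x: "x \<in> U" "down x \<in> S" and y: "y \<in> U" "down y \<in> S"
      and b: "b \<in> carrier (omap G (\<Inter>S))" for S x y b
  proof (rule cosheaf_hom_eqI[OF G oS[OF S] cK _ _ _ b])
    have hom: "(\<lambda>b. \<kappa> w (mmap G (\<Inter>S) (down w) () b)) \<in> hom (omap G (\<Inter>S)) K"
      if "w \<in> U" "down w \<in> S" for w
      using hom_compose[OF precosheaf_hom[OF fG oS[OF S] od[OF that(1)]] \<kappa>h[OF that(1), simplified]] that(2)
      by (auto simp: o_def)
    show "(\<lambda>b. \<kappa> x (mmap G (\<Inter>S) (down x) () b)) \<in> hom (omap G (\<Inter>S)) K"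
      "(\<lambda>b. \<kappa> y (mmap G (\<Inter>S) (down y) () b)) \<in> hom (omap G (\<Inter>S)) K"
      using hom x y by auto
    fix z a assume z: "z \<in> \<Inter>S" and a: "a \<in> carrier (omap G (down z))"
    have zU: "z \<in> U" using z x down_subset[OF U x(1)] by blast
    have "\<kappa> w (mmap G (\<Inter>S) (down w) () (mmap G (down z) (\<Inter>S) () a)) = \<kappa> z a"
      if w: "w \<in> U" "down w \<in> S" for w
    proof -
      have "leq z w" using z w(2) by (auto simp: down_def)
      then have "\<kappa> w (mmap G (down z) (down w) () a) = \<kappa> z a"
        using hat_obj_in_commute[OF fR UP zU w(1)] a by (simp add: \<kappa>_def)
      moreover have "\<Inter>S \<subseteq> down w" using w(2) by blast
      ultimately show ?thesis
        using precosheaf_comp[OF fG od[OF zU] oS[OF S] od[OF w(1)] down_subset[OF oS[OF S] z] _ a]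
        by simp
    qed
    then show "\<kappa> x (mmap G (\<Inter>S) (down x) () (mmap G (down z) (\<Inter>S) () a))
        = \<kappa> y (mmap G (\<Inter>S) (down y) () (mmap G (down z) (\<Inter>S) () a))"
      using x y by simp
  qed
  have "\<forall>S\<in>nerve_sets \<U>. \<exists>x. x \<in> U \<and> down x \<in> S"
  proof
    fix S assume S: "S \<in> nerve_sets \<U>"
    then obtain V where "V \<in> S" by blast
    moreover from this S obtain x where "x \<in> U" "V = down x" by (auto simp: \<U>_def)
    ultimately show "\<exists>x. x \<in> U \<and> down x \<in> S" by blast
  qed
  from bchoice[OF this] obtain v
    where v: "\<forall>S\<in>nerve_sets \<U>. v S \<in> U \<and> down (v S) \<in> S" by blast
  have vU: "v S \<in> U" and vS: "down (v S) \<in> S" and vsub: "\<Inter>S \<subseteq> down (v S)"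
    if "S \<in> nerve_sets \<U>" for S using bspec[OF v that] by auto
  define \<psi> where "\<psi> = (\<lambda>S a. \<kappa> (v S) (mmap G (\<Inter>S) (down (v S)) () a))"
  have \<psi>: "cocone (nerve \<U>) D K \<psi>"
    unfolding nerve_def
  proof (rule poset_coconeI[OF cK])
    fix S assume S: "S \<in> nerve_sets \<U>"
    show "\<psi> S \<in> hom (omap D S) K"
      using hom_compose[OF precosheaf_hom[OF fG oS[OF S] od[OF vU[OF S]] vsub[OF S]] \<kappa>h[OF vU[OF S], simplified]]
      by (simp add: DS \<psi>_def o_def)
  next
    fix S T a
    assume S: "S \<in> nerve_sets \<U>" and T: "T \<in> nerve_sets \<U>" and TS: "T \<subseteq> S"
      and a: "a \<in> carrier (omap D S)"
    have "\<psi> T (mmap D S T () a) = \<kappa> (v T) (mmap G (\<Inter>S) (down (v T)) () a)"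
      using precosheaf_comp[OF fG oS[OF S] oS[OF T] od[OF vU[OF T]] nerve_Inter_mono[OF S TS] vsub[OF T]] a
      by (simp add: \<psi>_def DS) (simp add: D_def nerve_diagram_def)
    also have "\<dots> = \<psi> S a"
      unfolding \<psi>_def using a vS[OF T] TS
      by (intro indep[OF S vU[OF T] _ vU[OF S] vS[OF S]]) (auto simp: DS)
    finally show "\<psi> T (mmap D S T () a) = \<psi> S a" .
  qed
  define g where "g = induced_map (nerve \<U>) D L \<iota> K \<psi>"
  have g: "g \<in> hom L K"
    unfolding g_def by (rule induced_map_hom[OF L \<psi>])
  have g_app: "g (\<iota> S a) = \<psi> S a" if "S \<in> nerve_sets \<U>" "a \<in> carrier (omap G (\<Inter>S))" for S a
    unfolding g_def using that by (intro induced_map_apply[OF L \<psi>]) (simp_all add: nerve_def DS)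
  obtain m where m: "group_isomorphisms L (omap G U) n m"
    using n group.iso_iff_group_isomorphisms[OF comm_group_imp_group[OF cocone_comm_group[OF \<iota>c]]] by blast
  then have nh: "n \<in> hom L (omap G U)" and mh: "m \<in> hom (omap G U) L"
    and mn: "\<And>c. c \<in> carrier L \<Longrightarrow> m (n c) = c" and nm: "\<And>b. b \<in> carrier (omap G U) \<Longrightarrow> n (m b) = b"
    by (auto simp: group_isomorphisms_def)
  have gm: "(\<lambda>b. g (m b)) \<in> hom (omap G U) K" using hom_compose[OF mh g] by (simp add: o_def)
  \<comment> \<open>The counit after \<open>g\<close> is the nerve map \<open>n\<close>, so
    \<open>g\<close> after the inverse \<open>m\<close> of \<open>n\<close> is a right inverse of
    the counit. That it is also a left inverse is checked below on the coprojections of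
    \<open>K\<close>.\<close>
  have eg: "counit G U (g c) = n c" if c: "c \<in> carrier L" for c
  proof (rule colimit_hom_eqI[OF L precosheaf_comm_group[OF fG U] _ nh _ c])
    show "(\<lambda>c. counit G U (g c)) \<in> hom L (omap G U)" using hom_compose[OF g e] by (simp add: o_def)
    fix S a assume "S \<in> Obj (nerve \<U>)" and a': "a \<in> carrier (omap D S)"
    then have S: "S \<in> nerve_sets \<U>" by (simp add: nerve_def)
    have a: "a \<in> carrier (omap G (\<Inter>S))" using a' by (simp add: DS)
    have "mmap G (\<Inter>S) (down (v S)) () a \<in> carrier (omap G (down (v S)))"
      by (rule precosheaf_closed[OF fG oS[OF S] od[OF vU[OF S]] vsub[OF S] a])
    then show "counit G U (g (\<iota> S a)) = n (\<iota> S a)"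
      using precosheaf_comp[OF fG oS[OF S] od[OF vU[OF S]] U vsub[OF S] down_subset[OF U vU[OF S]] a]
      by (simp add: g_app[OF S a] n_app[OF S a] \<psi>_def e_app[OF vU[OF S]])
  qed
  have "counit G U \<in> iso K (omap G U)"
  proof (rule hom_iso_byWitness[OF e gm])
    fix z assume z: "z \<in> carrier K"
    have ge: "(\<lambda>z. g (m (counit G U z))) \<in> hom K K" using hom_compose[OF e gm] by (simp add: o_def)
    have id: "(\<lambda>z. z) \<in> hom K K" by (simp add: hom_def)
    show "g (m (counit G U z)) = z"
    proof (rule hat_obj_eqI[OF fR UP cK[unfolded K_def] ge[unfolded K_def] id[unfolded K_def] _ z[unfolded K_def], folded \<kappa>_def])
      fix x a assume x: "x \<in> U" and "a \<in> carrier (omap R x)"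
      then have a: "a \<in> carrier (omap G (down x))" by simp
      have S: "{down x} \<in> nerve_sets \<U>" using x down_self[OF mP[OF x]] by (auto simp: \<U>_def)
      have a': "a \<in> carrier (omap G (\<Inter>{down x}))" using a by simp
      have i: "\<iota> {down x} a \<in> carrier L"
        using hom_in_carrier[OF poset_cocone_hom[OF \<iota>c[unfolded nerve_def] S]] a by (simp add: DS)
      have "m (counit G U (\<kappa> x a)) = \<iota> {down x} a"
        using mn[OF i] n_app[OF S a'] by (simp add: e_app[OF x a])
      then have "g (m (counit G U (\<kappa> x a))) = \<psi> {down x} a" using g_app[OF S a'] by simp
      also have "\<dots> = \<kappa> x (mmap G (\<Inter>{down x}) (down x) () a)"
        \<comment> \<open>The index chosen for the vertex \<open>{down x}\<close> is only known to
          have the same minimal open set as \<open>x\<close>; \<open>indep\<close> replaces it by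
          \<open>x\<close>.\<close>
        unfolding \<psi>_def by (rule indep[OF S vU[OF S] vS[OF S] x _ a']) simp
      also have "\<dots> = \<kappa> x a" using precosheaf_id[OF fG od[OF x] a] by simp
      finally show "g (m (counit G U (\<kappa> x a))) = \<kappa> x a" .
    qed
  next
    fix b assume b: "b \<in> carrier (omap G U)"
    show "counit G U (g (m b)) = b"
      using eg[OF hom_in_carrier[OF mh b]] nm[OF b] by simp
  qed
  then show ?thesis by (simp add: K_def R_def)
qed

end

section \<open>The equivalence\<close>

lemma functor_cat_simps [simp]:
  "F \<in> Obj (functor_cat C D) \<longleftrightarrow> is_functor C D F"
  "\<eta> \<in> Hom (functor_cat C D) F G \<longleftrightarrow> is_natural C D F G \<eta>"
  "Ident (functor_cat C D) F = (\<lambda>A\<in>Obj C. Ident D (omap F A))"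
  "Comp (functor_cat C D) F G H \<beta> \<alpha> =
     (\<lambda>A\<in>Obj C. Comp D (omap F A) (omap G A) (omap H A) (\<beta> A) (\<alpha> A))"
  by (simp_all add: functor_cat_def)

lemma Cosh_simps [simp]:
  "G \<in> Obj (Cosh X) \<longleftrightarrow> is_cosheaf X G"
  "Hom (Cosh X) G H = Hom (functor_cat (open_cat X) Ab) G H"
  "Ident (Cosh X) G = Ident (functor_cat (open_cat X) Ab) G"
  "Comp (Cosh X) F G H \<beta> \<alpha> = Comp (functor_cat (open_cat X) Ab) F G H \<beta> \<alpha>"
  by (simp_all add: Cosh_def functor_cat_def)

lemma category_Cosh: "is_category (Cosh X)"
  unfolding Cosh_def
  by (rule category_full_subcategory[OF category_functor_cat]) (auto dest: cosheaf_functor)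

text \<open>\<open>Cosh\<close> is a full subcategory, so the inverse found in the functor category
  is already one of its arrows.\<close>

lemma Cosh_isoI:
  assumes "is_cosheaf X G" and "is_cosheaf X H" and "is_natural (open_cat X) Ab G H \<eta>"
    and "\<And>U. openin X U \<Longrightarrow> is_isomorphism Ab (omap G U) (omap H U) (\<eta> U)"
  shows "is_isomorphism (Cosh X) G H \<eta>"
proof -
  have "is_isomorphism (functor_cat (open_cat X) Ab) G H \<eta>"
    by (rule functor_cat_isoI) (use assms in \<open>auto dest: cosheaf_functor simp: open_cat_def\<close>)
  then show ?thesis by (simp add: is_isomorphism_def)
qed

lemma iso_cong:
  assumes "comm_group G" and "f \<in> iso G H" and "\<And>x. x \<in> carrier G \<Longrightarrow> f x = g x"
  shows "g \<in> iso G H"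
proof -
  have "f \<in> hom G H" and "bij_betw f (carrier G) (carrier H)"
    using assms(2) by (simp_all add: iso_def)
  then show ?thesis
    using hom_cong[OF assms(1) _ assms(3)] assms(3)
      bij_betw_cong[of "carrier G" f g "carrier H"] by (simp add: iso_def)
qed

lemma Obj_open_cat [simp]: "Obj (open_cat X) = {U. openin X U}"
  by (simp add: open_cat_def)

lemma natural_open_hom:
  "is_natural (open_cat X) Ab G H \<eta> \<Longrightarrow> openin X U \<Longrightarrow> \<eta> U \<in> hom (omap G U) (omap H U)"
  using natural_component[of "open_cat X" Ab G H \<eta> U] by simp

lemma natural_open_extensional:
  "is_natural (open_cat X) Ab G H \<eta> \<Longrightarrow> openin X U \<Longrightarrow> \<eta> U \<in> extensional (carrier (omap G U))"
  using natural_component[of "open_cat X" Ab G H \<eta> U] by simp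

lemma natural_open_square:
  "\<lbrakk>is_natural (open_cat X) Ab G H \<eta>; openin X U; openin X V; U \<subseteq> V; a \<in> carrier (omap G U)\<rbrakk>
   \<Longrightarrow> \<eta> V (mmap G U V () a) = mmap H U V () (\<eta> U a)"
  unfolding open_cat_def
  by (rule natural_poset_square[of "{U. openin X U}" "(\<subseteq>)"]) auto

context small_poset
begin

section \<open>The functor \<open>hat\<close>\<close>

lemma hat_omap [simp]: "omap (hat P leq) F = hat_obj leq F"
  by (simp add: hat_def)

text \<open>The functor laws of \<open>hat\<close> are equalities of arrows, so agreement on the
  carrier has to be raised to equality of functions.\<close>

lemma hat_obj_extensional_eqI:
  fixes F :: "('a, unit, 'u monoid, 'u \<Rightarrow> 'u) cfunctor" and A :: "'b monoid"
  assumes "is_functor (sub_cat P) Ab F" and "U \<subseteq> P" and "comm_group A"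
    and "h \<in> hom (Ab_colim (sub_cat U) F) A" and "h \<in> extensional (carrier (Ab_colim (sub_cat U) F))"
    and "k \<in> hom (Ab_colim (sub_cat U) F) A" and "k \<in> extensional (carrier (Ab_colim (sub_cat U) F))"
    and "\<And>x a. \<lbrakk>x \<in> U; a \<in> carrier (omap F x)\<rbrakk> \<Longrightarrow>
           h (Ab_colim_in (sub_cat U) F x a) = k (Ab_colim_in (sub_cat U) F x a)"
  shows "h = k"
  by (rule extensionalityI[OF assms(5,7)]) (rule hat_obj_eqI[OF assms(1-4,6,8)])

text \<open>Naturality of \<eta> is what makes the coprojections of \<open>G\<close>, preceded by
  \<eta>, a cocone on \<open>F\<close>.\<close>

lemma
  fixes F G :: "('a, unit, 'u monoid, 'u \<Rightarrow> 'u) cfunctor"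
  assumes F: "is_functor (sub_cat P) Ab F" and G: "is_functor (sub_cat P) Ab G"
    and \<eta>: "is_natural (sub_cat P) Ab F G \<eta>" and U: "openin X U"
  shows hat_mmap_hom:
      "mmap (hat P leq) F G \<eta> U \<in> hom (Ab_colim (sub_cat U) F) (Ab_colim (sub_cat U) G)"
    and hat_mmap_extensional:
      "mmap (hat P leq) F G \<eta> U \<in> extensional (carrier (Ab_colim (sub_cat U) F))"
    and hat_mmap_apply: "\<And>x a. \<lbrakk>x \<in> U; a \<in> carrier (omap F x)\<rbrakk> \<Longrightarrow>
      mmap (hat P leq) F G \<eta> U (Ab_colim_in (sub_cat U) F x a) = Ab_colim_in (sub_cat U) G x (\<eta> x a)"
proof -
  note UP = openin_subset_P[OF U]
  note m = openin_memD[OF U]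
  have c: "cocone (sub_cat U) F (Ab_colim (sub_cat U) G) (\<lambda>x a. Ab_colim_in (sub_cat U) G x (\<eta> x a))"
  proof (rule poset_coconeI[OF hat_obj_comm_group[OF G UP]])
    show "(\<lambda>a. Ab_colim_in (sub_cat U) G x (\<eta> x a)) \<in> hom (omap F x) (Ab_colim (sub_cat U) G)"
      if "x \<in> U" for x
      using hom_compose[OF natural_poset_hom[OF \<eta> m[OF that]] hat_obj_in_hom[OF G UP that]]
      by (simp add: o_def)
    fix x y a assume h: "x \<in> U" "y \<in> U" "leq x y" "a \<in> carrier (omap F x)"
    show "Ab_colim_in (sub_cat U) G y (\<eta> y (mmap F x y () a)) = Ab_colim_in (sub_cat U) G x (\<eta> x a)"
      using natural_poset_square[OF \<eta> m[OF h(1)] m[OF h(2)] h(3,4)]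
        hat_obj_in_commute[OF G UP h(1-3) hom_in_carrier[OF natural_poset_hom[OF \<eta> m[OF h(1)]] h(4)]]
      by simp
  qed
  note C = hat_obj_colimit[OF F UP]
  have e: "mmap (hat P leq) F G \<eta> U = induced_map (sub_cat U) F
      (Ab_colim (sub_cat U) F) (Ab_colim_in (sub_cat U) F)
      (Ab_colim (sub_cat U) G) (\<lambda>x a. Ab_colim_in (sub_cat U) G x (\<eta> x a))"
    using U by (simp add: hat_def)
  show "mmap (hat P leq) F G \<eta> U \<in> hom (Ab_colim (sub_cat U) F) (Ab_colim (sub_cat U) G)"
    unfolding e by (rule induced_map_hom[OF C c])
  show "mmap (hat P leq) F G \<eta> U \<in> extensional (carrier (Ab_colim (sub_cat U) F))"
    unfolding e by (rule induced_map_extensional[OF C c])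
  show "mmap (hat P leq) F G \<eta> U (Ab_colim_in (sub_cat U) F x a) = Ab_colim_in (sub_cat U) G x (\<eta> x a)"
    if "x \<in> U" "a \<in> carrier (omap F x)" for x a
    unfolding e using that by (intro induced_map_apply[OF C c]) simp_all
qed

text \<open>On the coprojection at \<open>x\<close>, both ways round the square give the
  coprojection of \<open>\<eta> x a\<close> into the colimit of \<open>G\<close> over
  \<open>V\<close>.\<close>

lemma hat_mmap_natural:
  fixes F G :: "('a, unit, 'u monoid, 'u \<Rightarrow> 'u) cfunctor"
  assumes F: "is_functor (sub_cat P) Ab F" and G: "is_functor (sub_cat P) Ab G"
    and \<eta>: "is_natural (sub_cat P) Ab F G \<eta>"
  shows "is_natural (open_cat X) Ab (hat_obj leq F) (hat_obj leq G) (mmap (hat P leq) F G \<eta>)"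
  unfolding open_cat_def
proof (rule natural_posetI)
  show "mmap (hat P leq) F G \<eta> \<in> extensional {U. openin X U}" by (simp add: hat_def)
  show "mmap (hat P leq) F G \<eta> U \<in> hom (omap (hat_obj leq F) U) (omap (hat_obj leq G) U)"
    "mmap (hat P leq) F G \<eta> U \<in> extensional (carrier (omap (hat_obj leq F) U))"
    if "U \<in> {U. openin X U}" for U
    using hat_mmap_hom[OF assms] hat_mmap_extensional[OF assms] that by simp_all
next
  fix U V z
  assume h: "U \<in> {U. openin X U}" "V \<in> {U. openin X U}" "U \<subseteq> V"
    and z: "z \<in> carrier (omap (hat_obj leq F) U)"
  then have U: "openin X U" and V: "openin X V" by simp_all
  note UP = openin_subset_P[OF U] and VP = openin_subset_P[OF V]
  have hom: "(\<lambda>z. mmap (hat P leq) F G \<eta> V (mmap (hat_obj leq F) U V () z))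
      \<in> hom (Ab_colim (sub_cat U) F) (Ab_colim (sub_cat V) G)"
    "(\<lambda>z. mmap (hat_obj leq G) U V () (mmap (hat P leq) F G \<eta> U z))
      \<in> hom (Ab_colim (sub_cat U) F) (Ab_colim (sub_cat V) G)"
    using hom_compose[OF hat_obj_map_hom[OF F h(3) VP] hat_mmap_hom[OF assms V]]
      hom_compose[OF hat_mmap_hom[OF assms U] hat_obj_map_hom[OF G h(3) VP]] by (simp_all add: o_def)
  show "mmap (hat P leq) F G \<eta> V (mmap (hat_obj leq F) U V () z)
      = mmap (hat_obj leq G) U V () (mmap (hat P leq) F G \<eta> U z)"
  proof (rule hat_obj_eqI[OF F UP hat_obj_comm_group[OF G VP] hom])
    fix x a assume x: "x \<in> U" and a: "a \<in> carrier (omap F x)"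
    have xV: "x \<in> V" using x h(3) by blast
    show "mmap (hat P leq) F G \<eta> V (mmap (hat_obj leq F) U V () (Ab_colim_in (sub_cat U) F x a))
        = mmap (hat_obj leq G) U V () (mmap (hat P leq) F G \<eta> U (Ab_colim_in (sub_cat U) F x a))"
      using hat_obj_map_apply[OF F h(3) VP x a] hat_mmap_apply[OF assms V xV a]
        hat_mmap_apply[OF assms U x a]
        hat_obj_map_apply[OF G h(3) VP x hom_in_carrier[OF natural_poset_hom[OF \<eta> openin_memD[OF U x]] a]]
      by simp
  qed (use z in simp)
qed

lemma hat_functor:
  "is_functor (functor_cat (sub_cat P) (Ab :: ('u monoid, 'u \<Rightarrow> 'u) category)) (Cosh X) (hat P leq)"
  unfolding is_functor_def
proof (intro conjI ballI)
  show "is_category (functor_cat (sub_cat P) Ab)" by (rule category_functor_cat)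
  show "is_category (Cosh X)" by (rule category_Cosh)
next
  fix F :: "('a, unit, 'u monoid, 'u \<Rightarrow> 'u) cfunctor"
  assume "F \<in> Obj (functor_cat (sub_cat P) Ab)"
  then have F: "is_functor (sub_cat P) Ab F" by simp
  show "omap (hat P leq) F \<in> Obj (Cosh X)" using hat_obj_cosheaf[OF F] by simp
  have i: "is_natural (sub_cat P) Ab F F (\<lambda>x\<in>P. \<lambda>a\<in>carrier (omap F x). a)"
    using natural_id[OF F] by simp
  have "mmap (hat P leq) F F (\<lambda>x\<in>P. \<lambda>a\<in>carrier (omap F x). a)
      = (\<lambda>U\<in>Obj (open_cat X). Ident Ab (omap (hat_obj leq F) U))"
  proof (rule natural_eqI[OF hat_mmap_natural[OF F F i] natural_id[OF hat_obj_functor[OF F]]])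
    fix U assume "U \<in> Obj (open_cat X)"
    then have U: "openin X U" by simp
    note UP = openin_subset_P[OF U]
    have "mmap (hat P leq) F F (\<lambda>x\<in>P. \<lambda>a\<in>carrier (omap F x). a) U
        = (\<lambda>z\<in>carrier (Ab_colim (sub_cat U) F). z)"
    proof (rule hat_obj_extensional_eqI[OF F UP hat_obj_comm_group[OF F UP]
          hat_mmap_hom[OF F F i U] hat_mmap_extensional[OF F F i U]])
      show "(\<lambda>z\<in>carrier (Ab_colim (sub_cat U) F). z)
          \<in> hom (Ab_colim (sub_cat U) F) (Ab_colim (sub_cat U) F)"
        by (rule hom_cong[OF hat_obj_comm_group[OF F UP], of "\<lambda>z. z"]) (simp_all add: hom_def)
      fix x a assume x: "x \<in> U" and a: "a \<in> carrier (omap F x)"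
      show "mmap (hat P leq) F F (\<lambda>x\<in>P. \<lambda>a\<in>carrier (omap F x). a) U (Ab_colim_in (sub_cat U) F x a)
          = (\<lambda>z\<in>carrier (Ab_colim (sub_cat U) F). z) (Ab_colim_in (sub_cat U) F x a)"
        using hat_mmap_apply[OF F F i U x a] a openin_memD[OF U x] hat_obj_in_closed[OF F UP x a] by simp
    qed simp
    then show "mmap (hat P leq) F F (\<lambda>x\<in>P. \<lambda>a\<in>carrier (omap F x). a) U
        = (\<lambda>U\<in>Obj (open_cat X). Ident Ab (omap (hat_obj leq F) U)) U"
      using U by simp
  qed
  then show "mmap (hat P leq) F F (Ident (functor_cat (sub_cat P) Ab) F)
      = Ident (Cosh X) (omap (hat P leq) F)" by simp
next
  fix F G :: "('a, unit, 'u monoid, 'u \<Rightarrow> 'u) cfunctor" and \<eta>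
  assume "F \<in> Obj (functor_cat (sub_cat P) Ab)" "G \<in> Obj (functor_cat (sub_cat P) Ab)"
    "\<eta> \<in> Hom (functor_cat (sub_cat P) Ab) F G"
  then show "mmap (hat P leq) F G \<eta> \<in> Hom (Cosh X) (omap (hat P leq) F) (omap (hat P leq) G)"
    using hat_mmap_natural by simp
next
  fix F G H :: "('a, unit, 'u monoid, 'u \<Rightarrow> 'u) cfunctor" and \<alpha> \<beta>
  assume "F \<in> Obj (functor_cat (sub_cat P) Ab)" "G \<in> Obj (functor_cat (sub_cat P) Ab)"
    "H \<in> Obj (functor_cat (sub_cat P) Ab)"
    "\<alpha> \<in> Hom (functor_cat (sub_cat P) Ab) F G" "\<beta> \<in> Hom (functor_cat (sub_cat P) Ab) G H"
  then have F: "is_functor (sub_cat P) Ab F" and G: "is_functor (sub_cat P) Ab G"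
    and H: "is_functor (sub_cat P) Ab H"
    and \<alpha>: "is_natural (sub_cat P) Ab F G \<alpha>" and \<beta>: "is_natural (sub_cat P) Ab G H \<beta>" by simp_all
  let ?c = "\<lambda>x\<in>P. compose (carrier (omap F x)) (\<beta> x) (\<alpha> x)"
  have c: "is_natural (sub_cat P) Ab F H ?c"
    using natural_comp[OF F G H \<alpha> \<beta>] by simp
  have "mmap (hat P leq) F H ?c = (\<lambda>U\<in>Obj (open_cat X). Comp Ab (omap (hat_obj leq F) U)
      (omap (hat_obj leq G) U) (omap (hat_obj leq H) U)
      (mmap (hat P leq) G H \<beta> U) (mmap (hat P leq) F G \<alpha> U))"
  proof (rule natural_eqI[OF hat_mmap_natural[OF F H c] natural_comp[OF hat_obj_functor[OF F]
        hat_obj_functor[OF G] hat_obj_functor[OF H] hat_mmap_natural[OF F G \<alpha>] hat_mmap_natural[OF G H \<beta>]]])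
    fix U assume "U \<in> Obj (open_cat X)"
    then have U: "openin X U" by simp
    note UP = openin_subset_P[OF U]
    have "mmap (hat P leq) F H ?c U = compose (carrier (Ab_colim (sub_cat U) F))
        (mmap (hat P leq) G H \<beta> U) (mmap (hat P leq) F G \<alpha> U)"
    proof (rule hat_obj_extensional_eqI[OF F UP hat_obj_comm_group[OF H UP]
          hat_mmap_hom[OF F H c U] hat_mmap_extensional[OF F H c U]
          hom_compose_Ab[OF hat_obj_comm_group[OF F UP] hat_mmap_hom[OF F G \<alpha> U] hat_mmap_hom[OF G H \<beta> U]]
          compose_extensional])
      fix x a assume x: "x \<in> U" and a: "a \<in> carrier (omap F x)"
      note xP = openin_memD[OF U x]
      show "mmap (hat P leq) F H ?c U (Ab_colim_in (sub_cat U) F x a)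
          = compose (carrier (Ab_colim (sub_cat U) F)) (mmap (hat P leq) G H \<beta> U)
              (mmap (hat P leq) F G \<alpha> U) (Ab_colim_in (sub_cat U) F x a)"
        using hat_mmap_apply[OF F H c U x a] hat_mmap_apply[OF F G \<alpha> U x a] a xP
          hat_mmap_apply[OF G H \<beta> U x hom_in_carrier[OF natural_poset_hom[OF \<alpha> xP] a]]
          hat_obj_in_closed[OF F UP x a] by (simp add: compose_def)
    qed
    then show "mmap (hat P leq) F H ?c U = (\<lambda>U\<in>Obj (open_cat X). Comp Ab (omap (hat_obj leq F) U)
        (omap (hat_obj leq G) U) (omap (hat_obj leq H) U)
        (mmap (hat P leq) G H \<beta> U) (mmap (hat P leq) F G \<alpha> U)) U"
      using U by simp
  qed
  then show "mmap (hat P leq) F H (Comp (functor_cat (sub_cat P) Ab) F G H \<beta> \<alpha>)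
      = Comp (Cosh X) (omap (hat P leq) F) (omap (hat P leq) G) (omap (hat P leq) H)
          (mmap (hat P leq) G H \<beta>) (mmap (hat P leq) F G \<alpha>)" by simp
qed

section \<open>The quasi-inverse: evaluation on minimal open sets\<close>

definition restrict_functor ::
  "(('a set, unit, 'u monoid, 'u \<Rightarrow> 'u) cfunctor, 'a set \<Rightarrow> 'u \<Rightarrow> 'u,
    ('a, unit, 'u monoid, 'u \<Rightarrow> 'u) cfunctor, 'a \<Rightarrow> 'u \<Rightarrow> 'u) cfunctor" where
  "restrict_functor =
     \<lparr>omap = restrict_cosheaf down, mmap = (\<lambda>G H \<eta>. \<lambda>x\<in>P. \<eta> (down x))\<rparr>"

lemma restrict_functor_simps [simp]:
  "omap restrict_functor G = restrict_cosheaf down G"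
  "mmap restrict_functor G H \<eta> = (\<lambda>x\<in>P. \<eta> (down x))"
  by (simp_all add: restrict_functor_def)

lemma restrict_natural:
  assumes \<eta>: "is_natural (open_cat X) Ab G H \<eta>"
  shows "is_natural (sub_cat P) Ab (restrict_cosheaf down G) (restrict_cosheaf down H)
           (\<lambda>x\<in>P. \<eta> (down x))"
proof (rule natural_posetI)
  fix x assume x: "x \<in> P"
  show "(\<lambda>x\<in>P. \<eta> (down x)) x \<in> hom (omap (restrict_cosheaf down G) x) (omap (restrict_cosheaf down H) x)"
    "(\<lambda>x\<in>P. \<eta> (down x)) x \<in> extensional (carrier (omap (restrict_cosheaf down G) x))"
    using natural_open_hom[OF \<eta> openin_down[OF x]] natural_open_extensional[OF \<eta> openin_down[OF x]] x
    by simp_all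
next
  fix x y a assume "x \<in> P" "y \<in> P" "leq x y" "a \<in> carrier (omap (restrict_cosheaf down G) x)"
  then show "(\<lambda>x\<in>P. \<eta> (down x)) y (mmap (restrict_cosheaf down G) x y () a)
      = mmap (restrict_cosheaf down H) x y () ((\<lambda>x\<in>P. \<eta> (down x)) x a)"
    using natural_open_square[OF \<eta> openin_down openin_down down_mono] by simp
qed simp

lemma restrict_functor_functor:
  "is_functor (Cosh X) (functor_cat (sub_cat P) (Ab :: ('u monoid, 'u \<Rightarrow> 'u) category)) restrict_functor"
  unfolding is_functor_def
proof (intro conjI ballI)
  show "is_category (functor_cat (sub_cat P) Ab)" by (rule category_functor_cat)
  show "is_category (Cosh X)" by (rule category_Cosh)
next
  fix G :: "('a set, unit, 'u monoid, 'u \<Rightarrow> 'u) cfunctor"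
  assume G: "G \<in> Obj (Cosh X)"
  then show "omap restrict_functor G \<in> Obj (functor_cat (sub_cat P) Ab)"
    using restrict_cosheaf_functor[OF cosheaf_functor] by simp
  show "mmap restrict_functor G G (Ident (Cosh X) G)
      = Ident (functor_cat (sub_cat P) Ab) (omap restrict_functor G)"
    using openin_down by (auto intro!: restrict_ext)
next
  fix G H :: "('a set, unit, 'u monoid, 'u \<Rightarrow> 'u) cfunctor" and \<eta>
  assume "\<eta> \<in> Hom (Cosh X) G H"
  then show "mmap restrict_functor G H \<eta>
      \<in> Hom (functor_cat (sub_cat P) Ab) (omap restrict_functor G) (omap restrict_functor H)"
    using restrict_natural by simp
next
  fix G H K :: "('a set, unit, 'u monoid, 'u \<Rightarrow> 'u) cfunctor" and \<alpha> \<beta>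
  show "mmap restrict_functor G K (Comp (Cosh X) G H K \<beta> \<alpha>)
      = Comp (functor_cat (sub_cat P) Ab) (omap restrict_functor G) (omap restrict_functor H)
          (omap restrict_functor K) (mmap restrict_functor H K \<beta>) (mmap restrict_functor G H \<alpha>)"
    using openin_down by (auto intro!: restrict_ext)
qed

section \<open>The unit\<close>

definition unit :: "('a, unit, 'u monoid, 'u \<Rightarrow> 'u) cfunctor \<Rightarrow> 'a \<Rightarrow> 'u \<Rightarrow> 'u" where
  "unit F = (\<lambda>x\<in>P. \<lambda>a\<in>carrier (omap F x). Ab_colim_in (sub_cat (down x)) F x a)"

lemma unit_apply:
  "x \<in> P \<Longrightarrow> a \<in> carrier (omap F x) \<Longrightarrow> unit F x a = Ab_colim_in (sub_cat (down x)) F x a"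
  by (simp add: unit_def)

text \<open>For \<open>x\<close> below \<open>y\<close>, both ways round the square are the
  coprojection at \<open>x\<close> into the colimit over \<open>down y\<close>. The two restrictions
  in \<open>unit\<close> supply the required extensionality.\<close>

lemma unit_natural:
  assumes F: "is_functor (sub_cat P) Ab F"
  shows "is_natural (sub_cat P) Ab F (restrict_cosheaf down (hat_obj leq F)) (unit F)"
proof (rule natural_posetI)
  show "unit F \<in> extensional P" by (simp add: unit_def)
next
  fix x assume x: "x \<in> P"
  have cg: "comm_group (omap F x)" using functor_Ab_comm_group[OF F, of x] x by simp
  show "unit F x \<in> hom (omap F x) (omap (restrict_cosheaf down (hat_obj leq F)) x)"
    using hom_cong[OF cg hat_obj_in_hom[OF F down_subset_P down_self[OF x]], of "unit F x"]
    by (simp add: unit_apply[OF x])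
  show "unit F x \<in> extensional (carrier (omap F x))" using x by (simp add: unit_def)
next
  fix x y a assume h: "x \<in> P" "y \<in> P" "leq x y" "a \<in> carrier (omap F x)"
  have xy: "x \<in> down y" using h by (simp add: down_def)
  show "unit F y (mmap F x y () a) = mmap (restrict_cosheaf down (hat_obj leq F)) x y () (unit F x a)"
    using hat_obj_map_apply[OF F down_mono[OF h(1-3)] down_subset_P down_self[OF h(1)] h(4)]
      hat_obj_in_commute[OF F down_subset_P xy down_self[OF h(2)] h(3,4)]
      poset_functor_closed[OF F h] by (simp add: unit_apply h)
qed

lemma unit_iso:
  assumes F: "is_functor (sub_cat P) Ab F"
  shows "is_isomorphism (functor_cat (sub_cat P) Ab) F (restrict_cosheaf down (hat_obj leq F)) (unit F)"
proof (rule functor_cat_isoI[OF F restrict_cosheaf_functor[OF hat_obj_functor[OF F]] unit_natural[OF F]])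
  fix x assume "x \<in> Obj (sub_cat P)"
  then have x: "x \<in> P" by simp
  have cg: "comm_group (omap F x)" using functor_Ab_comm_group[OF F, of x] x by simp
  have "unit F x \<in> iso (omap F x) (Ab_colim (sub_cat (down x)) F)"
    by (rule iso_cong[OF cg hat_obj_in_down_iso[OF F x]]) (simp add: unit_apply[OF x])
  then show "is_isomorphism Ab (omap F x) (omap (restrict_cosheaf down (hat_obj leq F)) x) (unit F x)"
    using hat_obj_comm_group[OF F down_subset_P]
    by (intro Ab_isoI[OF cg]) (simp_all add: unit_def x)
qed

section \<open>The counit as an isomorphism of cosheaves\<close>

lemma counit_natural:
  assumes G: "is_functor (open_cat X) Ab G"
  shows "is_natural (open_cat X) Ab (hat_obj leq (restrict_cosheaf down G)) G
           (\<lambda>U\<in>{U. openin X U}. counit G U)"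
  unfolding open_cat_def
proof (rule natural_posetI)
  fix U assume U: "U \<in> {U. openin X U}"
  then show "(\<lambda>U\<in>{U. openin X U}. counit G U) U
      \<in> hom (omap (hat_obj leq (restrict_cosheaf down G)) U) (omap G U)"
    "(\<lambda>U\<in>{U. openin X U}. counit G U) U
      \<in> extensional (carrier (omap (hat_obj leq (restrict_cosheaf down G)) U))"
    using counit_hom[OF G] counit_extensional[OF G] by simp_all
next
  fix U V z
  assume h: "U \<in> {U. openin X U}" "V \<in> {U. openin X U}" "U \<subseteq> V"
    and z: "z \<in> carrier (omap (hat_obj leq (restrict_cosheaf down G)) U)"
  then have U: "openin X U" and V: "openin X V" by simp_all
  note UP = openin_subset_P[OF U] and VP = openin_subset_P[OF V]
  note R = restrict_cosheaf_functor[OF G]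
  let ?R = "restrict_cosheaf down G"
  have hom: "(\<lambda>z. counit G V (mmap (hat_obj leq ?R) U V () z)) \<in> hom (Ab_colim (sub_cat U) ?R) (omap G V)"
    "(\<lambda>z. mmap G U V () (counit G U z)) \<in> hom (Ab_colim (sub_cat U) ?R) (omap G V)"
    using hom_compose[OF hat_obj_map_hom[OF R h(3) VP] counit_hom[OF G V]]
      hom_compose[OF counit_hom[OF G U] precosheaf_hom[OF G U V h(3)]] by (simp_all add: o_def)
  have "counit G V (mmap (hat_obj leq ?R) U V () z) = mmap G U V () (counit G U z)"
  proof (rule hat_obj_eqI[OF R UP precosheaf_comm_group[OF G V] hom])
    fix x a assume x: "x \<in> U" and a': "a \<in> carrier (omap ?R x)"
    have a: "a \<in> carrier (omap G (down x))" using a' by simp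
    have xV: "x \<in> V" using x h(3) by blast
    \<comment> \<open>Both sides are the extension of \<open>a\<close> from \<open>down x\<close> to
      \<open>V\<close>.\<close>
    show "counit G V (mmap (hat_obj leq ?R) U V () (Ab_colim_in (sub_cat U) ?R x a))
        = mmap G U V () (counit G U (Ab_colim_in (sub_cat U) ?R x a))"
      using hat_obj_map_apply[OF R h(3) VP x a'] counit_apply[OF G V xV a] counit_apply[OF G U x a]
        precosheaf_comp[OF G openin_down[OF openin_memD[OF U x]] U V down_subset[OF U x] h(3) a]
      by simp
  qed (use z in simp)
  then show "(\<lambda>U\<in>{U. openin X U}. counit G U) V (mmap (hat_obj leq ?R) U V () z)
      = mmap G U V () ((\<lambda>U\<in>{U. openin X U}. counit G U) U z)"
    using U V by simp
qed simp

lemma counit_Cosh_iso: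
  assumes G: "is_cosheaf X G"
  shows "is_isomorphism (Cosh X) (hat_obj leq (restrict_cosheaf down G)) G
           (\<lambda>U\<in>{U. openin X U}. counit G U)"
proof (rule Cosh_isoI[OF _ G counit_natural[OF cosheaf_functor[OF G]]])
  note fG = cosheaf_functor[OF G]
  note R = restrict_cosheaf_functor[OF fG]
  show "is_cosheaf X (hat_obj leq (restrict_cosheaf down G))" by (rule hat_obj_cosheaf[OF R])
  fix U assume U: "openin X U"
  show "is_isomorphism Ab (omap (hat_obj leq (restrict_cosheaf down G)) U) (omap G U)
      ((\<lambda>U\<in>{U. openin X U}. counit G U) U)"
    using Ab_isoI[OF hat_obj_comm_group[OF R openin_subset_P[OF U]] precosheaf_comm_group[OF fG U]
        counit_iso[OF G U] counit_extensional[OF fG U]] U by simp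
qed

text \<open>\<open>unit_natural\<close> settles naturality in the poset variable. The square in the
  variable \<open>F\<close> is the defining equation of \<open>hat\<close> on arrows, read at the
  coprojection of \<open>x\<close> over \<open>down x\<close>.\<close>

lemma unit_natural_iso:
  "is_natural_iso (functor_cat (sub_cat P) Ab) (functor_cat (sub_cat P) Ab) id_functor
     (comp_functor restrict_functor (hat P leq)) (\<lambda>F\<in>Obj (functor_cat (sub_cat P) Ab). unit F)"
  unfolding is_natural_iso_def is_natural_def
proof (intro conjI ballI)
  show "(\<lambda>F\<in>Obj (functor_cat (sub_cat P) Ab). unit F)
      \<in> (\<Pi>\<^sub>E F\<in>Obj (functor_cat (sub_cat P) Ab). Hom (functor_cat (sub_cat P) Ab)
            (omap id_functor F) (omap (comp_functor restrict_functor (hat P leq)) F))"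
    using unit_natural by (simp add: PiE_iff id_functor_def comp_functor_def)
next
  fix F :: "('a, unit, 'u monoid, 'u \<Rightarrow> 'u) cfunctor"
  assume "F \<in> Obj (functor_cat (sub_cat P) Ab)"
  then show "is_isomorphism (functor_cat (sub_cat P) Ab) (omap id_functor F)
      (omap (comp_functor restrict_functor (hat P leq)) F)
      ((\<lambda>F\<in>Obj (functor_cat (sub_cat P) Ab). unit F) F)"
    using unit_iso by (simp add: id_functor_def comp_functor_def)
next
  fix F G :: "('a, unit, 'u monoid, 'u \<Rightarrow> 'u) cfunctor" and \<eta>
  assume "F \<in> Obj (functor_cat (sub_cat P) Ab)" "G \<in> Obj (functor_cat (sub_cat P) Ab)"
    "\<eta> \<in> Hom (functor_cat (sub_cat P) Ab) F G"
  then have F: "is_functor (sub_cat P) Ab F" and G: "is_functor (sub_cat P) Ab G"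
    and \<eta>: "is_natural (sub_cat P) Ab F G \<eta>" by simp_all
  have "compose (carrier (omap F x)) (unit G x) (\<eta> x)
      = compose (carrier (omap F x)) (mmap (hat P leq) F G \<eta> (down x)) (unit F x)" if x: "x \<in> P" for x
    unfolding compose_def
  proof (rule restrict_ext)
    fix a assume a: "a \<in> carrier (omap F x)"
    show "unit G x (\<eta> x a) = mmap (hat P leq) F G \<eta> (down x) (unit F x a)"
      using hat_mmap_apply[OF F G \<eta> openin_down[OF x] down_self[OF x] a]
        hom_in_carrier[OF natural_poset_hom[OF \<eta> x] a] by (simp add: unit_apply x a)
  qed
  then show "Comp (functor_cat (sub_cat P) Ab) (omap id_functor F) (omap id_functor G)
        (omap (comp_functor restrict_functor (hat P leq)) G)
        ((\<lambda>F\<in>Obj (functor_cat (sub_cat P) Ab). unit F) G) (mmap id_functor F G \<eta>)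
      = Comp (functor_cat (sub_cat P) Ab) (omap id_functor F)
        (omap (comp_functor restrict_functor (hat P leq)) F)
        (omap (comp_functor restrict_functor (hat P leq)) G)
        (mmap (comp_functor restrict_functor (hat P leq)) F G \<eta>)
        ((\<lambda>F\<in>Obj (functor_cat (sub_cat P) Ab). unit F) F)"
    using F G by (auto simp: id_functor_def comp_functor_def intro!: restrict_ext)
qed

text \<open>On the coprojection at \<open>x\<close>, the square in the variable \<open>G\<close>
  becomes naturality of \<eta> for the inclusion of \<open>down x\<close> in
  \<open>U\<close>.\<close>

lemma counit_natural_iso:
  "is_natural_iso (Cosh X) (Cosh X) (comp_functor (hat P leq) restrict_functor) id_functor
     (\<lambda>G\<in>Obj (Cosh X). \<lambda>U\<in>{U. openin X U}. counit G U)"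
  unfolding is_natural_iso_def is_natural_def
proof (intro conjI ballI)
  show "(\<lambda>G\<in>Obj (Cosh X). \<lambda>U\<in>{U. openin X U}. counit G U)
      \<in> (\<Pi>\<^sub>E G\<in>Obj (Cosh X). Hom (Cosh X)
            (omap (comp_functor (hat P leq) restrict_functor) G) (omap id_functor G))"
    using counit_natural[OF cosheaf_functor] by (simp add: PiE_iff id_functor_def comp_functor_def)
next
  fix G :: "('a set, unit, 'u monoid, 'u \<Rightarrow> 'u) cfunctor"
  assume "G \<in> Obj (Cosh X)"
  then show "is_isomorphism (Cosh X) (omap (comp_functor (hat P leq) restrict_functor) G)
      (omap id_functor G) ((\<lambda>G\<in>Obj (Cosh X). \<lambda>U\<in>{U. openin X U}. counit G U) G)"
    using counit_Cosh_iso by (simp add: id_functor_def comp_functor_def)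
next
  fix G H :: "('a set, unit, 'u monoid, 'u \<Rightarrow> 'u) cfunctor" and \<eta>
  assume "G \<in> Obj (Cosh X)" "H \<in> Obj (Cosh X)" "\<eta> \<in> Hom (Cosh X) G H"
  then have cG: "is_cosheaf X G" and cH: "is_cosheaf X H"
    and \<eta>: "is_natural (open_cat X) Ab G H \<eta>" by simp_all
  note G = cosheaf_functor[OF cG] and H = cosheaf_functor[OF cH]
  let ?G = "restrict_cosheaf down G" and ?H = "restrict_cosheaf down H"
  note RG = restrict_cosheaf_functor[OF G] and RH = restrict_cosheaf_functor[OF H]
  note R\<eta> = restrict_natural[OF \<eta>]
  let ?h = "mmap (hat P leq) ?G ?H (\<lambda>x\<in>P. \<eta> (down x))"
  have "compose (carrier (Ab_colim (sub_cat U) ?G)) (counit H U) (?h U)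
      = compose (carrier (Ab_colim (sub_cat U) ?G)) (\<eta> U) (counit G U)" if U: "openin X U" for U
    unfolding compose_def
  proof (rule restrict_ext)
    fix z assume z: "z \<in> carrier (Ab_colim (sub_cat U) ?G)"
    have hom: "(\<lambda>z. counit H U (?h U z)) \<in> hom (Ab_colim (sub_cat U) ?G) (omap H U)"
      "(\<lambda>z. \<eta> U (counit G U z)) \<in> hom (Ab_colim (sub_cat U) ?G) (omap H U)"
      using hom_compose[OF hat_mmap_hom[OF RG RH R\<eta> U] counit_hom[OF H U]]
        hom_compose[OF counit_hom[OF G U] natural_open_hom[OF \<eta> U]] by (simp_all add: o_def)
    show "counit H U (?h U z) = \<eta> U (counit G U z)"
    proof (rule hat_obj_eqI[OF RG openin_subset_P[OF U] precosheaf_comm_group[OF H U] hom _ z])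
      fix x a assume x: "x \<in> U" and a': "a \<in> carrier (omap ?G x)"
      have a: "a \<in> carrier (omap G (down x))" using a' by simp
      note xP = openin_memD[OF U x]
      show "counit H U (?h U (Ab_colim_in (sub_cat U) ?G x a))
          = \<eta> U (counit G U (Ab_colim_in (sub_cat U) ?G x a))"
        using hat_mmap_apply[OF RG RH R\<eta> U x a'] xP counit_apply[OF G U x a]
          counit_apply[OF H U x hom_in_carrier[OF natural_open_hom[OF \<eta> openin_down[OF xP]] a]]
          natural_open_square[OF \<eta> openin_down[OF xP] U down_subset[OF U x] a] by simp
    qed
  qed
  then show "Comp (Cosh X) (omap (comp_functor (hat P leq) restrict_functor) G)
        (omap (comp_functor (hat P leq) restrict_functor) H) (omap id_functor H)
        ((\<lambda>G\<in>Obj (Cosh X). \<lambda>U\<in>{U. openin X U}. counit G U) H)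
        (mmap (comp_functor (hat P leq) restrict_functor) G H \<eta>)
      = Comp (Cosh X) (omap (comp_functor (hat P leq) restrict_functor) G) (omap id_functor G)
        (omap id_functor H) (mmap id_functor G H \<eta>)
        ((\<lambda>G\<in>Obj (Cosh X). \<lambda>U\<in>{U. openin X U}. counit G U) G)"
    using cG cH by (auto simp: id_functor_def comp_functor_def intro!: restrict_ext)
qed

lemma hat_equivalence:
  "is_equivalence (functor_cat (sub_cat P) (Ab :: ('u monoid, 'u \<Rightarrow> 'u) category)) (Cosh X) (hat P leq)"
  unfolding is_equivalence_def
  using hat_functor restrict_functor_functor unit_natural_iso counit_natural_iso by blast

end

theorem theorem2p8:
  fixes P :: "'a set" and leq :: "'a \<Rightarrow> 'a \<Rightarrow> bool"
  assumes "reflp_on P leq" and "transp_on P leq" and "antisymp_on P leq"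
    and "infinite (UNIV :: 'u set)" and "P \<lesssim> (UNIV :: 'u set)"
  shows "is_equivalence
           (functor_cat (poset_cat P leq) (Ab :: ('u monoid, 'u \<Rightarrow> 'u) category))
           (Cosh (alexandroff P leq))
           (hat P leq)"
proof -
  interpret small_poset P leq "TYPE('u)" using assms by unfold_locales
  show ?thesis by (rule hat_equivalence)
qed

end
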